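(* Let $\alpha>0$, let $u,v,\varphi\in H(\mathbb{D})$ with $\varphi(\mathbb{D})\subseteq\mathbb{D}$, and let $m>2$ be an integer. Put $\mathfrak{Q}=\{0,1,2,m,m+1,m+2\}$ and $$I_0=u'',\quad I_1=2u'\varphi'+u\varphi'',\quad I_2=u(\varphi')^2,\quad I_m=v'',\quad I_{m+1}=2v'\varphi'+v\varphi'',\quad I_{m+2}=v(\varphi')^2.$$ Then the following are equivalent: (i) the operator $T^m_{u,v,\varphi}:B_1\to\mathcal{Z}_\alpha$ is bounded; (ii) for each $j\in\mathfrak{Q}$, $$\max\Big\{\sup_{a\in\mathbb{D}}\|T^m_{u,v,\varphi}f_{j,a}\|_{\mathcal{Z}_\alpha},\ \sup_{z\in\mathbb{D}}(1-|z|^2)^\alpha|I_j(z)|\Big\}<\infty;$$ (iii) for each $k\in\mathfrak{Q}$, $$\sup_{z\in\mathbb{D}}\frac{(1-|z|^2)^\alpha|I_k(z)|}{(1-|\varphi(z)|^2)^k}<\infty.$$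
   Context: $\mathbb{D}$ is the open unit disc and $H(\mathbb{D})$ the space of analytic functions on $\mathbb{D}$. For $\alpha>0$, the Zygmund type space $\mathcal{Z}_\alpha$ consists of $f\in H(\mathbb{D})$ with $\sup_{z\in\mathbb{D}}(1-|z|^2)^\alpha|f''(z)|<\infty$, normed by $\|f\|_{\mathcal{Z}_\alpha}=|f(0)|+|f'(0)|+\sup_{z\in\mathbb{D}}(1-|z|^2)^\alpha|f''(z)|$. The minimal Möbius invariant space $B_1$ is the space of $f\in H(\mathbb{D})$ admitting a representation $f=\sum_{k\ge1}c_k\sigma_{a_k}$ with $a_k\in\mathbb{D}$, $\sum|c_k|<\infty$, where $\sigma_a(z)=\frac{a-z}{1-\bar a z}$, with norm the infimum of $\sum|c_k|$ over such representations; equivalently, $B_1$ is the set of $f\in H(\mathbb{D})$ with $f''\in L^1(\mathbb{D},dA)$, and $\|f\|_{B_1}$ is comparable to $|f(0)|+|f'(0)|+\int_{\mathbb{D}}|f''|\,dA$. For $m\in\mathbb{N}$, the generalized Stević–Sharma operator is $T^m_{u,v,\varphi}f(z)=u(z)f(\varphi(z))+v(z)f^{(m)}(\varphi(z))$. For $j\in\mathbb{N}\cup\{0\}$ and $a\in\mathbb{D}$, $f_{j,a}(z)=\left(\frac{1-|a|^2}{1-\bar a z}\right)^j$. *)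

theory Defs
  imports "HOL-Analysis.Analysis"
begin

definition disc :: "complex set" where "disc = ball 0 1"

definition sigma :: "complex \<Rightarrow> complex \<Rightarrow> complex" where
  "sigma a z = (a - z) / (1 - cnj a * z)"

definition B1_rep :: "(complex \<Rightarrow> complex) \<Rightarrow> (nat \<Rightarrow> complex) \<Rightarrow> (nat \<Rightarrow> complex) \<Rightarrow> bool" where
  "B1_rep f c a \<longleftrightarrow> summable (\<lambda>k. norm (c k)) \<and> (\<forall>k. a k \<in> disc) \<and>
     (\<forall>z\<in>disc. (\<lambda>k. c k * sigma (a k) z) sums f z)"

definition in_B1 :: "(complex \<Rightarrow> complex) \<Rightarrow> bool" where
  "in_B1 f \<longleftrightarrow> f holomorphic_on disc \<and> (\<exists>c a. B1_rep f c a)"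

definition B1_norm :: "(complex \<Rightarrow> complex) \<Rightarrow> real" where
  "B1_norm f = Inf {(\<Sum>k. norm (c k)) | c a. B1_rep f c a}"

definition in_Zyg :: "real \<Rightarrow> (complex \<Rightarrow> complex) \<Rightarrow> bool" where
  "in_Zyg \<alpha> g \<longleftrightarrow> g holomorphic_on disc \<and>
     (\<exists>M. \<forall>z\<in>disc. (1 - (norm z)\<^sup>2) powr \<alpha> * norm (deriv (deriv g) z) \<le> M)"

definition Zyg_norm :: "real \<Rightarrow> (complex \<Rightarrow> complex) \<Rightarrow> real" where
  "Zyg_norm \<alpha> g = norm (g 0) + norm (deriv g 0) +
     (SUP z\<in>disc. (1 - (norm z)\<^sup>2) powr \<alpha> * norm (deriv (deriv g) z))"

definition T_op :: "nat \<Rightarrow> (complex \<Rightarrow> complex) \<Rightarrow> (complex \<Rightarrow> complex) \<Rightarrow> (complex \<Rightarrow> complex)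
    \<Rightarrow> (complex \<Rightarrow> complex) \<Rightarrow> complex \<Rightarrow> complex" where
  "T_op m u v \<phi> f z = u z * f (\<phi> z) + v z * (deriv ^^ m) f (\<phi> z)"

definition bounded_B1_Zyg :: "real \<Rightarrow> ((complex \<Rightarrow> complex) \<Rightarrow> (complex \<Rightarrow> complex)) \<Rightarrow> bool" where
  "bounded_B1_Zyg \<alpha> T \<longleftrightarrow> (\<exists>C. \<forall>f. in_B1 f \<longrightarrow> in_Zyg \<alpha> (T f) \<and> Zyg_norm \<alpha> (T f) \<le> C * B1_norm f)"

definition test_fun :: "nat \<Rightarrow> complex \<Rightarrow> complex \<Rightarrow> complex" where
  "test_fun j a z = ((1 - (of_real ((norm a)\<^sup>2))) / (1 - cnj a * z)) ^ j"

text \<open>The functions I_j (only meaningful for j in {0,1,2,m,m+1,m+2}).\<close>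
definition I_fun :: "nat \<Rightarrow> (complex \<Rightarrow> complex) \<Rightarrow> (complex \<Rightarrow> complex) \<Rightarrow> (complex \<Rightarrow> complex)
    \<Rightarrow> nat \<Rightarrow> complex \<Rightarrow> complex" where
  "I_fun m u v \<phi> j z =
    (if j = 0 then deriv (deriv u) z
     else if j = 1 then 2 * deriv u z * deriv \<phi> z + u z * deriv (deriv \<phi>) z
     else if j = 2 then u z * (deriv \<phi> z)\<^sup>2
     else if j = m then deriv (deriv v) z
     else if j = m + 1 then 2 * deriv v z * deriv \<phi> z + v z * deriv (deriv \<phi>) z
     else if j = m + 2 then v z * (deriv \<phi> z)\<^sup>2
     else 0)"

end

(* Boundedness on B_1 follows from the quotient bounds by Cauchy's inequality, since the B_1 norm
   dominates the sup norm and (T f)'' is the sum of the I_k times the k-th derivative of f at phi.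
   The test functions are bounded in B_1: f_{1,a} = 1 - cnj a * sigma_a, so f_{j,a} is a polynomial
   in sigma_a, and by Moebius invariance only the monomials z^n have to lie in B_1. Averages of
   sigma_a over the points a = r w with w^N = 1 give z^n / (1 - (r z)^N), and a Neumann series
   turns these functions into z^n. Conversely, for a = phi z the test functions give a linear system
   for the quotients whose matrix of Pochhammer symbols is, up to a positive scaling of rows, the
   positive definite matrix with entries (j + k - 1)!. *)
theory Submission
  imports Defs "HOL-Complex_Analysis.Complex_Singularities"
begin

section \<open>Absolutely convergent combinations of disc automorphisms\<close>

text \<open>B_1 is given by atoms, so membership means exhibiting a representation, even for the
  constant 1. An average of atoms over roots of unity is z^n plus errors at higher powers, and its
  cost \<open>1 / ((1 - r^2) * r ^ (n - 1))\<close> is large both for r near 1 and for small r. The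
  choice \<open>r ^ n = 1 / 2\<close> balances the two and keeps the cost below 4 n. This cost is
  linear in the exponent, so the errors, with coefficients of modulus 1 / 16^(l+1) at the exponents
  n (4 l + 5), must be small after weighting by the exponent: the sum of (4 l + 5) / 16^(l+1) is
  below 1/2. With 2 n points instead of 4 n the sum of (2 l + 3) / 4^(l+1) is 11/9, and nothing
  contracts. The coefficient bounds in (ii) cover what the linear system loses: at a = \<phi> z its
  unknowns carry the factor \<open>cnj a ^ k\<close>, which is useless for a near 0. Under (i) these
  bounds come from the monomials, which are thus needed twice.\<close>

lemma disc_mult_neq_1:
  assumes "a \<in> disc" "z \<in> disc"
  shows "1 - cnj a * z \<noteq> 0"
proof -
  have "norm (cnj a * z) < 1"
    using mult_strict_mono'[of "norm a" 1 "norm z" 1] assms by (simp add: norm_mult disc_def)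
  then show ?thesis
    by (metis norm_one order_less_irrefl right_minus_eq)
qed

lemma sigma_in_disc:
  assumes "a \<in> disc" "z \<in> disc"
  shows "sigma a z \<in> disc"
proof -
  have a: "norm a < 1" and z: "norm z < 1"
    using assms by (auto simp: disc_def)
  have nz: "1 - cnj a * z \<noteq> 0"
    using assms by (rule disc_mult_neq_1)
  have "complex_of_real ((norm (1 - cnj a * z))\<^sup>2 - (norm (a - z))\<^sup>2)
      = complex_of_real ((1 - (norm a)\<^sup>2) * (1 - (norm z)\<^sup>2))"
    by (simp only: of_real_diff of_real_mult of_real_1 complex_norm_square) (simp add: algebra_simps)
  then have "(norm (1 - cnj a * z))\<^sup>2 - (norm (a - z))\<^sup>2 = (1 - (norm a)\<^sup>2) * (1 - (norm z)\<^sup>2)"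
    using of_real_eq_iff by blast
  moreover have "\<dots> > 0"
    using a z by (intro mult_pos_pos) (auto simp: power_less_one_iff)
  ultimately have "norm (a - z) < norm (1 - cnj a * z)"
    using power2_less_imp_less[of "norm (a - z)" "norm (1 - cnj a * z)"] by simp
  then show ?thesis
    using nz by (simp add: sigma_def norm_divide disc_def)
qed

lemma norm_sigma_le_1: "a \<in> disc \<Longrightarrow> z \<in> disc \<Longrightarrow> norm (sigma a z) \<le> 1"
  using sigma_in_disc[of a z] by (simp add: disc_def)

definition B1_le :: "(complex \<Rightarrow> complex) \<Rightarrow> real \<Rightarrow> bool" where
  "B1_le f K \<longleftrightarrow> (\<exists>c a. B1_rep f c a \<and> (\<Sum>k. norm (c k)) \<le> K)"

lemma B1_le_sigma:
  assumes "a \<in> disc"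
  shows "B1_le (sigma a) 1"
proof -
  define c where "c = (\<lambda>k::nat. if k = 0 then 1 else 0 :: complex)"
  have "(\<lambda>k. norm (c k)) sums 1"
    using sums_If_finite_set[of "{0}" "\<lambda>_. 1 :: real"] by (simp add: c_def if_distrib cong: if_cong)
  moreover have "(\<lambda>k. c k * sigma a z) sums sigma a z" for z
    using sums_If_finite_set[of "{0}" "\<lambda>_. sigma a z"]
    by (simp add: c_def if_distrib[of "\<lambda>x. x * _"] cong: if_cong)
  ultimately show ?thesis
    unfolding B1_le_def B1_rep_def using assms
    by (intro exI[of _ c] exI[of _ "\<lambda>_. a"]) (auto simp: sums_iff)
qed

lemma B1_le_cong:
  assumes "B1_le f K" "\<And>z. z \<in> disc \<Longrightarrow> f z = g z"
  shows "B1_le g K"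
  using assms unfolding B1_le_def B1_rep_def by metis

lemma B1_le_mono: "B1_le f K \<Longrightarrow> K \<le> L \<Longrightarrow> B1_le f L"
  unfolding B1_le_def by (meson order_trans)

lemma B1_le_cmult:
  assumes "B1_le f K"
  shows "B1_le (\<lambda>z. s * f z) (norm s * K)"
proof -
  obtain c a where c: "B1_rep f c a" "(\<Sum>k. norm (c k)) \<le> K"
    using assms by (auto simp: B1_le_def)
  have "B1_rep (\<lambda>z. s * f z) (\<lambda>k. s * c k) a"
    using c(1) unfolding B1_rep_def
    by (auto simp: norm_mult mult.assoc intro!: summable_mult sums_mult)
  moreover have "(\<Sum>k. norm (s * c k)) \<le> norm s * K"
    using c unfolding B1_rep_def by (simp add: norm_mult suminf_mult mult_left_mono)
  ultimately show ?thesis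
    unfolding B1_le_def by blast
qed

text \<open>This is completeness of B_1 in the form needed here: representations of the summands are
  merged into one double series. Pointwise convergence to \<open>g\<close> suffices, since the atoms
  are bounded by 1 and the costs are summable.\<close>

lemma B1_le_sums:
  assumes f: "\<And>i::nat. B1_le (f i) (K i)" and K: "summable K"
    and g: "\<And>z. z \<in> disc \<Longrightarrow> (\<lambda>i. f i z) sums g z"
  shows "B1_le g (\<Sum>i. K i)"
proof -
  obtain C A where CA: "\<And>i. B1_rep (f i) (C i) (A i)" and CK: "\<And>i. (\<Sum>k. norm (C i k)) \<le> K i"
    using f unfolding B1_le_def by metis
  define N where "N = (\<lambda>i. \<Sum>k. norm (C i k))"
  have sumC: "summable (\<lambda>k. norm (C i k))" and A: "A i k \<in> disc"
    and fz: "z \<in> disc \<Longrightarrow> (\<lambda>k. C i k * sigma (A i k) z) sums f i z" for i k z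
    using CA unfolding B1_rep_def by auto
  have N0: "N i \<ge> 0" for i
    unfolding N_def by (intro suminf_nonneg sumC) auto
  have NK: "N i \<le> K i" for i
    using CK by (simp add: N_def)
  have sumN: "summable N"
    using K by (rule summable_comparison_test') (use N0 NK in auto)
  have hsC: "((\<lambda>k. norm (C i k)) has_sum N i) UNIV" for i
    unfolding N_def by (rule sums_nonneg_imp_has_sum) (use sumC in \<open>auto intro: summable_sums\<close>)
  have hsN: "(N has_sum (\<Sum>i. N i)) UNIV"
    by (rule sums_nonneg_imp_has_sum) (use sumN N0 in \<open>auto intro: summable_sums\<close>)
  \<comment> \<open>Absolute summability over all pairs permits any order of summation;
    \<open>prod_decode\<close> then lists the pairs as the single sequence that
    \<open>B1_rep\<close> asks for.\<close>
  have absC: "(\<lambda>(i,k). norm (C i k)) summable_on (UNIV \<times> UNIV)"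
    by (rule summable_on_SigmaI[where g = N]) (use hsC hsN in \<open>auto simp: summable_on_def\<close>)
  have "((\<lambda>(i,k). norm (C i k)) has_sum (\<Sum>i. N i)) (UNIV \<times> UNIV)"
    by (rule has_sum_SigmaI[where g = N]) (use hsC hsN absC in auto)
  then have "((\<lambda>n. (\<lambda>(i,k). norm (C i k)) (prod_decode n)) has_sum (\<Sum>i. N i)) UNIV"
    by (subst has_sum_reindex_bij_betw[OF bij_prod_decode]) simp
  then have sums: "(\<lambda>n. norm (C (fst (prod_decode n)) (snd (prod_decode n)))) sums (\<Sum>i. N i)"
    by (simp add: case_prod_unfold has_sum_imp_sums)
  have rep: "(\<lambda>n. C (fst (prod_decode n)) (snd (prod_decode n))
      * sigma (A (fst (prod_decode n)) (snd (prod_decode n))) z) sums g z" if z: "z \<in> disc" for z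
  proof -
    let ?h = "\<lambda>(i,k). C i k * sigma (A i k) z"
    have le: "norm (?h (i,k)) \<le> norm (C i k)" for i k
      using norm_sigma_le_1[OF A z] by (simp add: norm_mult mult_left_le)
    have hs: "((\<lambda>k. ?h (i,k)) has_sum f i z) UNIV" for i
    proof (rule norm_summable_imp_has_sum)
      show "summable (\<lambda>k. norm (?h (i,k)))"
        using sumC[of i] by (rule summable_comparison_test') (use le in auto)
      show "(\<lambda>k. ?h (i,k)) sums f i z"
        using fz[OF z] by simp
    qed
    have hsg: "((\<lambda>i. f i z) has_sum g z) UNIV"
    proof (rule norm_summable_imp_has_sum)
      have "norm (f i z) \<le> N i" for i
        by (rule norm_infsum_le[OF hs[of i] hsC[of i]]) (rule le)
      then show "summable (\<lambda>i. norm (f i z))"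
        by (intro summable_comparison_test'[OF sumN]) simp
    qed (rule g[OF z])
    have "(\<lambda>p. norm (?h p)) summable_on (UNIV \<times> UNIV)"
      by (rule summable_on_comparison_test[OF absC]) (use le in auto)
    then have "?h summable_on (UNIV \<times> UNIV)"
      by (rule abs_summable_summable)
    then have "(?h has_sum g z) (UNIV \<times> UNIV)"
      by (intro has_sum_SigmaI[where g = "\<lambda>i. f i z"]) (use hs hsg in auto)
    then have "((\<lambda>n. ?h (prod_decode n)) has_sum g z) UNIV"
      by (subst has_sum_reindex_bij_betw[OF bij_prod_decode]) simp
    then show ?thesis
      by (simp add: case_prod_unfold has_sum_imp_sums)
  qed
  have "(\<Sum>i. N i) \<le> (\<Sum>i. K i)"
    by (intro suminf_le NK sumN K)
  then show ?thesis
    unfolding B1_le_def B1_rep_def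
    using sums rep A
    by (intro exI[of _ "\<lambda>n. C (fst (prod_decode n)) (snd (prod_decode n))"]
        exI[of _ "\<lambda>n. A (fst (prod_decode n)) (snd (prod_decode n))"]) (auto simp: sums_iff)
qed

lemma B1_le_zero: "B1_le (\<lambda>_. 0) 0"
  using B1_le_cmult[OF B1_le_sigma, of 0 0] by (simp add: disc_def)

lemma B1_le_sum:
  assumes "\<And>i. i < n \<Longrightarrow> B1_le (f i) (K i)"
  shows "B1_le (\<lambda>z. \<Sum>i<n::nat. f i z) (\<Sum>i<n. K i)"
proof -
  define F where "F = (\<lambda>i. if i < n then f i else (\<lambda>_. 0))"
  define L where "L = (\<lambda>i. if i < n then K i else 0)"
  have "B1_le (F i) (L i)" for i
    using assms B1_le_zero by (auto simp: F_def L_def)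
  moreover have "L sums (\<Sum>i<n. K i)"
    using sums_If_finite_set[of "{..<n}" K] by (simp add: L_def)
  moreover have "(\<lambda>i. F i z) sums (\<Sum>i<n. f i z)" for z
    using sums_If_finite_set[of "{..<n}" "\<lambda>i. f i z"] by (simp add: F_def if_distrib[of "\<lambda>g. g _"])
  ultimately show ?thesis
    using B1_le_sums[of F L "\<lambda>z. \<Sum>i<n. f i z"] by (auto simp: sums_iff)
qed

lemma B1_le_add:
  assumes "B1_le f K" "B1_le g L"
  shows "B1_le (\<lambda>z. f z + g z) (K + L)"
  using B1_le_sum[of 2 "\<lambda>i. if i = 0 then f else g" "\<lambda>i. if i = 0 then K else L"] assms
  by (simp add: numeral_2_eq_2)

section \<open>Moebius invariance and the sup norm\<close>

text \<open>The composite is a disc automorphism whose zero is \<open>sigma a b\<close>, because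
  \<open>sigma a\<close> is an involution. Hence it is a constant multiple of
  \<open>sigma (sigma a b)\<close>.\<close>

lemma sigma_compose:
  assumes "a \<in> disc" "b \<in> disc" "z \<in> disc"
  shows "sigma b (sigma a z) = - ((1 - cnj a * b) / (1 - cnj b * a)) * sigma (sigma a b) z"
proof -
  have ab: "1 - cnj a * b \<noteq> 0" and ba: "1 - cnj b * a \<noteq> 0" and az: "1 - cnj a * z \<noteq> 0"
    and c: "1 - cnj b * sigma a z \<noteq> 0"
    using assms by (simp_all only: disc_mult_neq_1 sigma_in_disc not_False_eq_True)
  define P where "P = 1 - cnj a * b"
  define R where "R = 1 - cnj b * a"
  define S where "S = 1 - cnj a * z"
  define N where "N = (b - a) + z * P"
  have n1: "b - sigma a z = N / S"
    using az by (simp add: N_def sigma_def P_def S_def field_simps)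
  have d1: "1 - cnj b * sigma a z = (R - cnj (a - b) * z) / S"
    using az by (simp add: sigma_def R_def S_def field_simps)
  have n2: "sigma a b - z = - N / P"
    using ab by (simp add: N_def sigma_def P_def field_simps)
  have cs: "cnj (sigma a b) = cnj (a - b) / R"
    by (simp add: sigma_def R_def mult.commute)
  have d2: "1 - cnj (sigma a b) * z = (R - cnj (a - b) * z) / R"
    using ba unfolding cs by (simp add: R_def field_simps)
  have nz: "R - cnj (a - b) * z \<noteq> 0" "S \<noteq> 0" "P \<noteq> 0" "R \<noteq> 0"
    using c[unfolded d1] az ab ba by (auto simp: S_def P_def R_def)
  have "sigma b (sigma a z) = N / (R - cnj (a - b) * z)"
    unfolding sigma_def[of b] n1 d1 using nz by simp
  moreover have "sigma (sigma a b) z = - (N / (R - cnj (a - b) * z)) * (R / P)"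
    unfolding sigma_def[of "sigma a b"] n2 d2 using nz by simp
  ultimately show ?thesis
    unfolding P_def[symmetric] R_def[symmetric] using nz by simp
qed

text \<open>Composition turns atoms into multiples of atoms by the factors \<open>l b\<close>, which
  are unimodular because numerator and denominator are conjugate. So the cost does not
  change.\<close>

lemma B1_le_moebius:
  assumes "B1_le f K" "a \<in> disc"
  shows "B1_le (\<lambda>z. f (sigma a z)) K"
proof -
  obtain c b where c: "B1_rep f c b" "(\<Sum>k. norm (c k)) \<le> K"
    using assms by (auto simp: B1_le_def)
  define l where "l = (\<lambda>b. - ((1 - cnj a * b) / (1 - cnj b * a)))"
  have l: "norm (l b) = 1" if "b \<in> disc" for b
  proof -
    have "norm (1 - cnj a * b) = norm (cnj (1 - cnj a * b))"
      by (simp only: complex_mod_cnj)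
    then have "norm (1 - cnj a * b) = norm (1 - cnj b * a)"
      by (simp add: mult.commute)
    moreover have "1 - cnj b * a \<noteq> 0"
      using disc_mult_neq_1[OF that assms(2)] .
    ultimately show ?thesis
      by (simp add: l_def norm_divide)
  qed
  have b: "b k \<in> disc" for k
    using c(1) by (simp add: B1_rep_def)
  have n: "norm (c k * l (b k)) = norm (c k)" for k
    using l[OF b] by (simp add: norm_mult)
  have "B1_rep (\<lambda>z. f (sigma a z)) (\<lambda>k. c k * l (b k)) (\<lambda>k. sigma a (b k))"
    unfolding B1_rep_def n
  proof (intro conjI allI ballI)
    fix z assume z: "z \<in> disc"
    have "(\<lambda>k. c k * sigma (b k) (sigma a z)) sums f (sigma a z)"
      using c(1) sigma_in_disc[OF assms(2) z] by (simp add: B1_rep_def)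
    then show "(\<lambda>k. c k * l (b k) * sigma (sigma a (b k)) z) sums f (sigma a z)"
      using sigma_compose[OF assms(2) b z] by (simp add: l_def mult.assoc)
  qed (use c(1) assms(2) sigma_in_disc in \<open>auto simp: B1_rep_def\<close>)
  then show ?thesis
    using c(2) unfolding B1_le_def n[symmetric] by blast
qed

text \<open>Besides the sup norm estimate, this yields the pointwise summability that gives the
  \<open>suminf\<close> in \<open>neumann_term\<close> its meaning.\<close>

lemma B1_le_norm:
  assumes "B1_le f K" "z \<in> disc"
  shows "norm (f z) \<le> K"
proof -
  obtain c a where c: "B1_rep f c a" "(\<Sum>k. norm (c k)) \<le> K"
    using assms(1) by (auto simp: B1_le_def)
  have 1: "norm (c k * sigma (a k) z) \<le> norm (c k)" for k
    using norm_sigma_le_1[of "a k" z] c(1) assms(2)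
    by (simp add: norm_mult mult_left_le B1_rep_def)
  have 2: "summable (\<lambda>k. norm (c k))" "(\<lambda>k. c k * sigma (a k) z) sums f z"
    using c(1) assms(2) by (auto simp: B1_rep_def)
  have "norm (f z) \<le> (\<Sum>k. norm (c k))"
    unfolding sums_unique[OF 2(2)] by (rule norm_suminf_le[OF 1 2(1)])
  then show ?thesis
    using c(2) by simp
qed

section \<open>Monomials and test functions\<close>

text \<open>In \<open>sigma a z = a - (1 - |a|^2) * z * (SUM k. (cnj a * z) ^ k)\<close> with
  \<open>a = r * \<omega> j\<close>, the weights \<open>\<omega> j ^ (n - 1)\<close> filter out the
  powers with k congruent to n - 1 modulo N. What survives is a geometric series in
  \<open>(r * z) ^ N\<close>.\<close>

lemma sum_roots_unity_sigma:
  fixes r :: real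
  assumes n: "n > 0" "n < N" and r: "0 < r" "r < 1" and z: "z \<in> disc"
  defines "\<omega> \<equiv> \<lambda>j. cis (2 * pi * real j / real N)"
  shows "(\<Sum>j<N. \<omega> j ^ (n - 1) * sigma (of_real r * \<omega> j) z)
    = - of_real (real N * (1 - r\<^sup>2) * r ^ (n - 1)) * (z ^ n / (1 - (of_real r * z) ^ N))"
proof -
  define x where "x = of_real r * z"
  have N: "N > 0" using n by simp
  have "norm x < 1"
    using mult_strict_mono'[of r 1 "norm z" 1] r z by (simp add: x_def norm_mult disc_def)
  then have "norm (x ^ N) < 1"
    using N by (simp add: norm_power power_less_one_iff)
  then have xN: "1 - x ^ N \<noteq> 0"
    by (metis norm_one order_less_irrefl right_minus_eq)
  have \<omega>_power: "\<omega> j ^ k = \<omega> k ^ j" for j k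
    by (simp add: \<omega>_def Complex.DeMoivre mult_ac)
  have \<omega>N: "\<omega> k ^ N = 1" for k
    using N by (simp add: \<omega>_def Complex.DeMoivre cis_multiple_2pi)
  have inj: "\<omega> k = \<omega> l \<longleftrightarrow> k = l" if "k < N" "l < N" for k l
    using Complex.bij_betw_roots_unity[OF N] that by (auto simp: \<omega>_def bij_betw_def dest: inj_onD)
  have unit: "cnj (\<omega> k) * \<omega> k = 1" for k
    by (simp add: \<omega>_def cis_cnj cis_mult)
  have orth: "(\<Sum>j<N. \<omega> j ^ k * cnj (\<omega> j) ^ l) = (if k = l then of_nat N else 0)"
    if "k < N" "l < N" for k l
  proof (cases "k = l")
    case True
    then show ?thesis
      by (simp add: power_mult_distrib[symmetric] mult.commute[of "\<omega> _"] unit)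
  next
    case False
    define y where "y = \<omega> k * cnj (\<omega> l)"
    have "y \<noteq> 1"
    proof
      assume "y = 1"
      then have "\<omega> k * (cnj (\<omega> l) * \<omega> l) = \<omega> l"
        by (simp add: y_def mult.assoc[symmetric])
      then show False
        using inj[OF that] False by (simp add: unit)
    qed
    moreover have "y ^ N = 1"
      by (simp add: y_def power_mult_distrib \<omega>N flip: complex_cnj_power)
    ultimately have "(\<Sum>j<N. y ^ j) = 0"
      using geometric_sum[of y N] by simp
    moreover have "\<omega> j ^ k * cnj (\<omega> j) ^ l = y ^ j" for j
      by (simp add: y_def power_mult_distrib \<omega>_power[of j] flip: complex_cnj_power)
    ultimately show ?thesis
      using False by simp
  qed
  \<comment> \<open>All \<open>y = x * cnj (\<omega> j)\<close> have the same power
    \<open>y ^ N = x ^ N\<close>, so \<open>1 / (1 - y)\<close> is a finite geometric sum over a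
    denominator independent of j. Only finite sums have to be interchanged.\<close>
  have sig: "sigma (of_real r * \<omega> j) z = of_real r * \<omega> j
      - of_real (1 - r\<^sup>2) * z / (1 - x ^ N) * (\<Sum>k<N. x ^ k * cnj (\<omega> j) ^ k)" for j
  proof -
    define y where "y = x * cnj (\<omega> j)"
    have a: "of_real r * \<omega> j \<in> disc"
      using r by (simp add: disc_def \<omega>_def norm_mult)
    have ny: "1 - y \<noteq> 0"
      using disc_mult_neq_1[OF a z] by (simp add: y_def x_def mult_ac)
    have "y ^ N = x ^ N"
      by (simp add: y_def power_mult_distrib \<omega>N flip: complex_cnj_power)
    then have "(\<Sum>k<N. y ^ k) = (1 - x ^ N) / (1 - y)"
      using geometric_sum[of y N] ny by (simp add: divide_simps) (simp add: algebra_simps)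
    then have "1 / (1 - y) = (\<Sum>k<N. y ^ k) / (1 - x ^ N)"
      using xN by simp
    moreover have "sigma (of_real r * \<omega> j) z = of_real r * \<omega> j - of_real (1 - r\<^sup>2) * z * (1 / (1 - y))"
    proof -
      have "y * \<omega> j = of_real r * z"
        using unit[of j] by (simp add: y_def x_def mult_ac)
      then have "(of_real r * \<omega> j) * (1 - y) - of_real (1 - r\<^sup>2) * z = of_real r * \<omega> j - z"
        by (simp add: algebra_simps power2_eq_square)
      moreover have "1 - cnj (of_real r * \<omega> j) * z = 1 - y"
        by (simp add: y_def x_def mult_ac)
      ultimately show ?thesis
        using ny by (simp add: sigma_def divide_simps)
    qed
    ultimately show ?thesis
      by (simp add: y_def power_mult_distrib)
  qed
  have "(\<Sum>j<N. \<omega> j ^ (n - 1) * sigma (of_real r * \<omega> j) z)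
    = of_real r * (\<Sum>j<N. \<omega> j ^ n * cnj (\<omega> j) ^ 0) - of_real (1 - r\<^sup>2) * z / (1 - x ^ N)
       * (\<Sum>j<N. \<Sum>k<N. x ^ k * (\<omega> j ^ (n - 1) * cnj (\<omega> j) ^ k))"
  proof -
    have "\<omega> j ^ (n - 1) * sigma (of_real r * \<omega> j) z
      = of_real r * (\<omega> j ^ n * cnj (\<omega> j) ^ 0) - of_real (1 - r\<^sup>2) * z / (1 - x ^ N)
       * (\<Sum>k<N. x ^ k * (\<omega> j ^ (n - 1) * cnj (\<omega> j) ^ k))" for j
    proof -
      have "(\<Sum>k<N. x ^ k * (\<omega> j ^ (n - 1) * cnj (\<omega> j) ^ k))
         = \<omega> j ^ (n - 1) * (\<Sum>k<N. x ^ k * cnj (\<omega> j) ^ k)"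
        by (simp add: sum_distrib_left mult_ac)
      moreover have "\<omega> j ^ n = \<omega> j * \<omega> j ^ (n - 1)"
        using n by (simp add: power_eq_if)
      ultimately show ?thesis
        by (simp only: sig) (simp only: algebra_simps power_0 mult_1_left)
    qed
    then show ?thesis
      by (simp only: sum_subtractf sum_distrib_left)
  qed
  \<comment> \<open>The constant terms of the atoms contribute the n-th moment of the roots, which
    vanishes because 0 < n < N.\<close>
  also have "(\<Sum>j<N. \<omega> j ^ n * cnj (\<omega> j) ^ 0) = 0"
    using n by (subst orth) auto
  also have "(\<Sum>j<N. \<Sum>k<N. x ^ k * (\<omega> j ^ (n - 1) * cnj (\<omega> j) ^ k))
     = (\<Sum>k<N. x ^ k * (\<Sum>j<N. \<omega> j ^ (n - 1) * cnj (\<omega> j) ^ k))"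
    by (subst sum.swap) (simp add: sum_distrib_left)
  also have "\<dots> = (\<Sum>k<N. if k = n - 1 then x ^ k * of_nat N else 0)"
    using n by (intro sum.cong refl) (auto simp: orth)
  also have "\<dots> = x ^ (n - 1) * of_nat N"
    using n by simp
  finally show ?thesis
    using n by (simp add: x_def power_mult_distrib power_eq_if[of z n])
qed

text \<open>The N unimodular weights cost N in total, and \<open>C\<close> contains the same factor.
  The bound is therefore free of N, which can be chosen later to make the error small.\<close>

lemma B1_le_geometric:
  fixes r :: real
  assumes n: "n > 0" "n < N" and r: "0 < r" "r < 1"
  shows "B1_le (\<lambda>z. z ^ n / (1 - (of_real r * z) ^ N)) (1 / ((1 - r\<^sup>2) * r ^ (n - 1)))"
proof -
  define \<omega> where "\<omega> = (\<lambda>j. cis (2 * pi * real j / real N))"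
  define C where "C = real N * (1 - r\<^sup>2) * r ^ (n - 1)"
  have "r\<^sup>2 < 1"
    using r by (simp add: power_less_one_iff)
  then have C: "C > 0"
    using n r by (auto simp: C_def)
  have "B1_le (\<lambda>z. \<Sum>j<N. \<omega> j ^ (n - 1) * sigma (of_real r * \<omega> j) z)
     (\<Sum>j<N. norm (\<omega> j ^ (n - 1)) * 1)"
    using r by (intro B1_le_sum B1_le_cmult B1_le_sigma) (auto simp: disc_def \<omega>_def norm_mult)
  note B1_le_cmult[OF this, of "- of_real (1 / C)"]
  moreover have "norm (- of_real (1 / C) :: complex) * (\<Sum>j<N. norm (\<omega> j ^ (n - 1)) * 1)
     = 1 / ((1 - r\<^sup>2) * r ^ (n - 1))"
    using C n by (simp add: \<omega>_def norm_power norm_divide) (simp add: C_def)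
  ultimately have "B1_le (\<lambda>z. - of_real (1 / C) * (\<Sum>j<N. \<omega> j ^ (n - 1) * sigma (of_real r * \<omega> j) z))
     (1 / ((1 - r\<^sup>2) * r ^ (n - 1)))"
    by (simp only:)
  then show ?thesis
  proof (rule B1_le_cong)
    fix z assume "z \<in> disc"
    from sum_roots_unity_sigma[OF n r this] C
    show "- of_real (1 / C) * (\<Sum>j<N. \<omega> j ^ (n - 1) * sigma (of_real r * \<omega> j) z)
        = z ^ n / (1 - (of_real r * z) ^ N)"
      unfolding \<omega>_def C_def[symmetric] by simp
  qed
qed

text \<open>
  Taking \<open>r ^ n = 1 / 2\<close> and \<open>N = 4 * n\<close> above, \<open>z ^ n\<close> equals \<open>neumann_term 0 n z\<close> minus the sum of
  \<open>(1 / 16) ^ Suc l * z ^ (n * (4 * l + 5))\<close> over \<open>l\<close>. Iterating this identity gives the terms of a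
  Neumann series, which contracts by at least 1/2 in each step for the weight \<open>n\<close>.
\<close>

primrec neumann_term :: "nat \<Rightarrow> nat \<Rightarrow> complex \<Rightarrow> complex" where
  "neumann_term 0 n z = z ^ n / (1 - z ^ (4 * n) / 16)"
| "neumann_term (Suc i) n z = (\<Sum>l. - ((1 / 16) ^ Suc l) * neumann_term i (n * (4 * l + 5)) z)"

section \<open>Convergence of the Neumann series, in cost and pointwise\<close>

text \<open>The estimate \<open>4 * l + 5 \<le> 5 * 2 ^ l\<close> absorbs the linear weight into the
  ratio. The right-hand sides sum to \<open>5 / 14 * n\<close>, which leaves room below
  \<open>n / 2\<close>.\<close>

lemma contraction_weight:
  "(1 / 16) ^ Suc l * (real n * (4 * real l + 5)) \<le> real n * (5 / 16 * (1 / 8) ^ l)"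
proof -
  have "4 * real l + 5 \<le> 5 * 2 ^ l"
  proof (induction l)
    case (Suc l)
    have "(1::real) \<le> 2 ^ l" by simp
    with Suc show ?case by simp
  qed simp
  then have "real n * (1 / 16) ^ Suc l * (4 * real l + 5) \<le> real n * (1 / 16) ^ Suc l * (5 * 2 ^ l)"
    by (rule mult_left_mono) simp
  moreover have "(1 / 16 :: real) ^ l * 2 ^ l = (1 / 8) ^ l"
    by (simp flip: power_mult_distrib)
  then have "real n * (1 / 16) ^ Suc l * (5 * 2 ^ l) = real n * (5 / 16 * (1 / 8) ^ l)"
    by simp
  ultimately show ?thesis
    by (simp only: mult_ac)
qed

lemma B1_le_neumann_term:
  assumes "n > 0"
  shows "B1_le (neumann_term i n) (4 * real n * (1 / 2) ^ i)"
  using assms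
proof (induction i arbitrary: n)
  case 0
  define r where "r = root n (1 / 2)"
  have r: "0 < r" "r < 1" and rn: "r ^ n = 1 / 2"
    using 0 by (auto simp: r_def)
  \<comment> \<open>Bernoulli turns \<open>r ^ n = 1 / 2\<close> into
    \<open>1 - r \<ge> 1 / (2 * n)\<close>. Together with \<open>r ^ (n - 1) \<ge> 1 / 2\<close>
    this gives the cost 4 n.\<close>
  have "1 + real n * (r - 1) \<le> (1 + (r - 1)) ^ n"
    using r by (intro Bernoulli_inequality) auto
  then have rr: "1 / (2 * real n) \<le> 1 - r"
    using 0 rn by (simp add: field_simps)
  have "r\<^sup>2 \<le> r"
    using r by (simp add: power2_eq_square mult_left_le)
  moreover have "r ^ n \<le> r ^ (n - 1)"
    using r by (intro power_decreasing) auto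
  ultimately have "1 / (2 * real n) * (1 / 2) \<le> (1 - r\<^sup>2) * r ^ (n - 1)"
    using rn rr r by (intro mult_mono) auto
  then have "1 / ((1 - r\<^sup>2) * r ^ (n - 1)) \<le> 1 / (1 / (2 * real n) * (1 / 2))"
    using 0 by (intro divide_left_mono mult_pos_pos) (use r in \<open>auto simp: abs_square_less_1\<close>)
  then have b: "1 / ((1 - r\<^sup>2) * r ^ (n - 1)) \<le> 4 * real n"
    by simp
  have "(of_real r * z) ^ (4 * n) = z ^ (4 * n) / 16" for z :: complex
  proof -
    have "(of_real r :: complex) ^ (4 * n) = of_real ((r ^ n) ^ 4)"
      by (simp add: power_mult[symmetric] mult.commute)
    also have "\<dots> = 1 / 16"
      unfolding rn by (simp add: power_divide)
    finally show ?thesis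
      by (simp add: power_mult_distrib)
  qed
  moreover have "B1_le (\<lambda>z. z ^ n / (1 - (of_real r * z) ^ (4 * n))) (4 * real n)"
    using 0 r by (intro B1_le_mono[OF B1_le_geometric b]) auto
  ultimately have "B1_le (\<lambda>z. z ^ n / (1 - z ^ (4 * n) / 16)) (4 * real n)"
    by (simp only:)
  then show ?case
    by simp
next
  case (Suc i)
  define K where "K = (\<lambda>l. 4 * (1 / 2) ^ i * (real n * (5 / 16 * (1 / 8) ^ l)))"
  define f where "f = (\<lambda>l z. - ((1 / 16) ^ Suc l) * neumann_term i (n * (4 * l + 5)) z)"
  have f: "B1_le (f l) (K l)" for l
  proof (rule B1_le_mono)
    show "B1_le (f l) (norm (- ((1 / 16) ^ Suc l) :: complex) * (4 * real (n * (4 * l + 5)) * (1 / 2) ^ i))"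
      unfolding f_def using Suc by (intro B1_le_cmult Suc.IH) auto
    have "norm (- ((1 / 16) ^ Suc l) :: complex) * (4 * real (n * (4 * l + 5)) * (1 / 2) ^ i)
      = 4 * (1 / 2) ^ i * ((1 / 16) ^ Suc l * (real n * (4 * real l + 5)))"
      by (simp add: norm_power norm_mult norm_divide mult_ac)
    also have "\<dots> \<le> K l"
      unfolding K_def by (intro mult_left_mono contraction_weight) auto
    finally show "norm (- ((1 / 16) ^ Suc l) :: complex) * (4 * real (n * (4 * l + 5)) * (1 / 2) ^ i) \<le> K l" .
  qed
  have "(\<lambda>l. 4 * (1 / 2) ^ i * (real n * (5 / 16 * (1 / 8) ^ l))) sums
      (4 * (1 / 2) ^ i * (real n * (5 / 16 * (1 / (1 - 1 / 8)))))"
    by (intro sums_mult geometric_sums) auto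
  note K_sums = this[folded K_def]
  have K: "summable K"
    using K_sums by (rule sums_summable)
  have K': "(\<Sum>l. K l) \<le> 4 * real n * (1 / 2) ^ Suc i"
    unfolding sums_unique[OF K_sums, symmetric] by simp
  have "(\<lambda>l. f l z) sums neumann_term (Suc i) n z" if z: "z \<in> disc" for z
  proof -
    have "summable (\<lambda>l. f l z)"
      by (rule summable_comparison_test'[OF K]) (rule B1_le_norm[OF f z])
    then show ?thesis
      by (simp add: f_def summable_sums)
  qed
  with B1_le_sums[OF f K] have "B1_le (neumann_term (Suc i) n) (\<Sum>l. K l)"
    by blast
  then show ?case
    using K' by (rule B1_le_mono)
qed

text \<open>The remainders obey the same recursion as the terms: the one of order
  \<open>Suc i\<close> at n combines those of order i at the exponents
  \<open>n * (4 * l + 5)\<close>. The induction starts from \<open>|z ^ n| \<le> 1 \<le> n\<close>,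
  and each step halves the weight.\<close>

lemma neumann_remainder:
  assumes "n > 0" "z \<in> disc"
  shows "norm (z ^ n - (\<Sum>j<i. neumann_term j n z)) \<le> real n * (1 / 2) ^ i"
  using assms(1)
proof (induction i arbitrary: n)
  case 0
  have "norm z ^ n \<le> 1"
    using assms(2) by (intro power_le_one) (auto simp: disc_def)
  then show ?case
    using 0 by (simp add: norm_power)
next
  case (Suc i)
  define c where "c = (\<lambda>l. - ((1 / 16) ^ Suc l) :: complex)"
  have z: "norm z < 1" using assms(2) by (simp add: disc_def)
  have 1: "(\<lambda>l. c l * z ^ (n * (4 * l + 5))) sums (z ^ n - neumann_term 0 n z)"
  proof -
    define q where "q = z ^ (4 * n) / 16"
    have "norm z ^ (4 * n) \<le> 1"
      using z by (intro power_le_one) auto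
    then have q: "norm q < 1"
      by (simp add: q_def norm_divide norm_power)
    then have q1: "1 - q \<noteq> 0"
      by (metis norm_one order_less_irrefl right_minus_eq)
    have "(\<lambda>l. - (z ^ n) * q * q ^ l) sums (- (z ^ n) * q * (1 / (1 - q)))"
      using q by (intro sums_mult geometric_sums)
    moreover have "- (z ^ n) * q * q ^ l = c l * z ^ (n * (4 * l + 5))" for l
      by (simp add: c_def q_def power_divide power_mult[symmetric] power_add[symmetric] algebra_simps)
    moreover have "- (z ^ n) * q * (1 / (1 - q)) = z ^ n - z ^ n / (1 - q)"
      using q1 by (simp add: field_simps)
    ultimately show ?thesis
      by (simp add: q_def)
  qed
  have 2: "(\<lambda>l. c l * neumann_term j (n * (4 * l + 5)) z) sums neumann_term (Suc j) n z" for j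
  proof -
    have "norm (c l * neumann_term j (n * (4 * l + 5)) z)
       \<le> 4 * (1 / 2) ^ j * (real n * (5 / 16 * (1 / 8) ^ l))" for l
    proof -
      have "norm (neumann_term j (n * (4 * l + 5)) z) \<le> 4 * real (n * (4 * l + 5)) * (1 / 2) ^ j"
        using Suc.prems by (intro B1_le_norm[OF B1_le_neumann_term] assms) auto
      then have "norm (c l * neumann_term j (n * (4 * l + 5)) z)
          \<le> (1 / 16) ^ Suc l * (4 * real (n * (4 * l + 5)) * (1 / 2) ^ j)"
        unfolding norm_mult by (intro mult_mono) (auto simp: c_def norm_power norm_mult norm_divide)
      also have "\<dots> = 4 * (1 / 2) ^ j * ((1 / 16) ^ Suc l * (real n * (4 * real l + 5)))"
        by (simp add: mult_ac)
      also have "\<dots> \<le> 4 * (1 / 2) ^ j * (real n * (5 / 16 * (1 / 8) ^ l))"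
        by (intro mult_left_mono contraction_weight) auto
      finally show ?thesis .
    qed
    moreover have "summable (\<lambda>l. 4 * (1 / 2) ^ j * (real n * (5 / 16 * (1 / 8) ^ l)))"
      by (intro summable_mult summable_geometric) auto
    ultimately have "summable (\<lambda>l. c l * neumann_term j (n * (4 * l + 5)) z)"
      by (rule summable_comparison_test'[rotated])
    then show ?thesis
      by (simp add: c_def summable_sums)
  qed
  have "(\<lambda>l. c l * z ^ (n * (4 * l + 5)) - (\<Sum>j<i. c l * neumann_term j (n * (4 * l + 5)) z)) sums
     (z ^ n - neumann_term 0 n z - (\<Sum>j<i. neumann_term (Suc j) n z))"
    by (intro sums_diff sums_sum 1 2)
  moreover have "(\<Sum>j<Suc i. neumann_term j n z) = neumann_term 0 n z + (\<Sum>j<i. neumann_term (Suc j) n z)"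
    by (rule sum.lessThan_Suc_shift)
  ultimately have sums: "(\<lambda>l. c l * (z ^ (n * (4 * l + 5)) - (\<Sum>j<i. neumann_term j (n * (4 * l + 5)) z)))
      sums (z ^ n - (\<Sum>j<Suc i. neumann_term j n z))"
    by (simp only: right_diff_distrib sum_distrib_left diff_diff_eq)
  have bound: "norm (c l * (z ^ (n * (4 * l + 5)) - (\<Sum>j<i. neumann_term j (n * (4 * l + 5)) z)))
      \<le> (1 / 2) ^ i * (real n * (5 / 16 * (1 / 8) ^ l))" for l
  proof -
    have "norm (z ^ (n * (4 * l + 5)) - (\<Sum>j<i. neumann_term j (n * (4 * l + 5)) z))
        \<le> real (n * (4 * l + 5)) * (1 / 2) ^ i"
      using Suc.prems by (intro Suc.IH) auto
    then have "norm (c l * (z ^ (n * (4 * l + 5)) - (\<Sum>j<i. neumann_term j (n * (4 * l + 5)) z)))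
       \<le> (1 / 16) ^ Suc l * (real (n * (4 * l + 5)) * (1 / 2) ^ i)"
      unfolding norm_mult by (intro mult_mono) (auto simp: c_def norm_power norm_mult norm_divide)
    also have "\<dots> = (1 / 2) ^ i * ((1 / 16) ^ Suc l * (real n * (4 * real l + 5)))"
      by (simp add: mult_ac)
    also have "\<dots> \<le> (1 / 2) ^ i * (real n * (5 / 16 * (1 / 8) ^ l))"
      by (intro mult_left_mono contraction_weight) auto
    finally show ?thesis .
  qed
  have gs: "(\<lambda>l. (1 / 2) ^ i * (real n * (5 / 16 * (1 / 8) ^ l))) sums
      ((1 / 2) ^ i * (real n * (5 / 16 * (1 / (1 - 1 / 8)))))"
    by (intro sums_mult geometric_sums) auto
  have "norm (z ^ n - (\<Sum>j<Suc i. neumann_term j n z))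
      \<le> (\<Sum>l. (1 / 2) ^ i * (real n * (5 / 16 * (1 / 8) ^ l)))"
    unfolding sums_unique[OF sums] by (rule norm_suminf_le[OF bound sums_summable[OF gs]])
  also have "\<dots> \<le> real n * (1 / 2) ^ Suc i"
    unfolding sums_unique[OF gs, symmetric] by simp
  finally show ?case .
qed

lemma B1_le_monomial_pos:
  assumes "n > 0"
  shows "B1_le (\<lambda>z. z ^ n) (8 * real n)"
proof -
  have K: "(\<lambda>i. 4 * real n * (1 / 2) ^ i) sums (4 * real n * (1 / (1 - 1 / 2)))"
    by (intro sums_mult geometric_sums) auto
  have "(\<lambda>i. neumann_term i n z) sums z ^ n" if z: "z \<in> disc" for z
  proof -
    have lim: "(\<lambda>i. real n * (1 / 2) ^ i) \<longlonglongrightarrow> 0"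
      by (rule tendsto_mult_right_zero[OF LIMSEQ_power_zero]) simp
    have "(\<lambda>i. (\<Sum>j<i. neumann_term j n z) - z ^ n) \<longlonglongrightarrow> 0"
      by (rule Lim_null_comparison[OF always_eventually lim])
        (use neumann_remainder[OF assms z] in \<open>simp add: norm_minus_commute\<close>)
    then have "(\<lambda>i. \<Sum>j<i. neumann_term j n z) \<longlonglongrightarrow> z ^ n"
      by (rule Lim_null[THEN iffD2])
    then show ?thesis
      by (simp add: sums_def)
  qed
  then have "B1_le (\<lambda>z. z ^ n) (\<Sum>i. 4 * real n * (1 / 2) ^ i)"
    by (rule B1_le_sums[OF B1_le_neumann_term[OF assms] sums_summable[OF K]])
  then show ?thesis
    unfolding sums_unique[OF K, symmetric] by simp
qed

section \<open>All monomials, and the test functions\<close>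

lemma B1_le_monomial: "\<exists>K. B1_le (\<lambda>z. z ^ n) K"
proof (cases "n = 0")
  case True \<comment> \<open>The Taylor series of \<open>sigma (1/2)\<close> has constant term 1/2 and monomials of positive degree.\<close>
  have h: "(1/2 :: complex) \<in> disc"
    by (simp add: disc_def norm_divide)
  have 1: "B1_le (\<lambda>z. (3 / 4) * (1 / 2) ^ l * z ^ Suc l) (6 * (real (Suc l) * (1 / 2) ^ l))" for l
  proof -
    have "norm ((3 / 4) * (1 / 2) ^ l :: complex) * (8 * real (Suc l)) = 6 * (real (Suc l) * (1 / 2) ^ l)"
      by (simp add: norm_mult norm_power norm_divide)
    then show ?thesis
      using B1_le_cmult[OF B1_le_monomial_pos[of "Suc l"], of "(3 / 4) * (1 / 2) ^ l"]
      by (simp only: zero_less_Suc simp_thms True_implies_equals)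
  qed
  have 2: "summable (\<lambda>l. 6 * (real (Suc l) * (1 / 2) ^ l))"
    using geometric_deriv_sums[of "1 / 2 :: real"] by (intro summable_mult) (auto simp: sums_iff)
  have 3: "(\<lambda>l. (3 / 4) * (1 / 2) ^ l * z ^ Suc l) sums (1 / 2 - sigma (1 / 2) z)" if z: "z \<in> disc" for z
  proof -
    have "norm (z / 2) < 1"
      using z by (simp add: disc_def norm_divide)
    then have "(\<lambda>l. (3 / 4) * z * (z / 2) ^ l) sums ((3 / 4) * z * (1 / (1 - z / 2)))"
      by (intro sums_mult geometric_sums)
    moreover have "1 - z / 2 \<noteq> 0"
      using disc_mult_neq_1[OF h z] by simp
    then have "(3 / 4) * z * (1 / (1 - z / 2)) = 1 / 2 - sigma (1 / 2) z"
      by (simp add: sigma_def divide_simps)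
    ultimately show ?thesis
      by (simp add: power_divide mult_ac)
  qed
  have "B1_le (\<lambda>z. 1 / 2 - sigma (1 / 2) z) (\<Sum>l. 6 * (real (Suc l) * (1 / 2) ^ l))"
    using B1_le_sums[OF 1 2 3] .
  from B1_le_cmult[OF B1_le_add[OF this B1_le_sigma[OF h]], of 2]
  have "\<exists>K. B1_le (\<lambda>z. 1) K"
    by auto
  then show ?thesis
    using True by simp
qed (use B1_le_monomial_pos in blast)

text \<open>Uniformity in \<open>a\<close> is the point: \<open>a\<close> enters the binomial
  expansion only through the coefficients \<open>(- cnj a) ^ i\<close>, of modulus at most 1, and
  through a Moebius substitution, which is free of charge.\<close>

lemma B1_le_test_fun: "\<exists>K. \<forall>a\<in>disc. B1_le (test_fun j a) K"
proof -
  obtain M where M: "\<And>i. B1_le (\<lambda>z. z ^ i) (M i)"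
    using B1_le_monomial by metis
  have "B1_le (test_fun j a) (\<Sum>i<Suc j. real (j choose i) * \<bar>M i\<bar>)" if a: "a \<in> disc" for a
  proof -
    have "B1_le (\<lambda>z. \<Sum>i<Suc j. (of_nat (j choose i) * (- cnj a) ^ i) * sigma a z ^ i)
      (\<Sum>i<Suc j. norm (of_nat (j choose i) * (- cnj a) ^ i) * M i)"
      by (intro B1_le_sum B1_le_cmult B1_le_moebius[OF M a])
    moreover have "norm (of_nat (j choose i) * (- cnj a) ^ i) * M i \<le> real (j choose i) * \<bar>M i\<bar>" for i
    proof -
      have "norm a ^ i \<le> 1"
        using a by (intro power_le_one) (auto simp: disc_def)
      then have "real (j choose i) * norm a ^ i * M i \<le> real (j choose i) * 1 * \<bar>M i\<bar>"
        by (intro order_trans[OF mult_left_mono mult_right_mono] mult_left_mono) auto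
      then show ?thesis
        by (simp add: norm_mult norm_power)
    qed
    ultimately have "B1_le (\<lambda>z. \<Sum>i<Suc j. (of_nat (j choose i) * (- cnj a) ^ i) * sigma a z ^ i)
       (\<Sum>i<Suc j. real (j choose i) * \<bar>M i\<bar>)"
      by (elim B1_le_mono) (intro sum_mono)
    moreover have "(\<Sum>i<Suc j. (of_nat (j choose i) * (- cnj a) ^ i) * sigma a z ^ i) = test_fun j a z"
      if z: "z \<in> disc" for z
    proof -
      have "(1 - (of_real ((norm a)\<^sup>2))) / (1 - cnj a * z) = - cnj a * sigma a z + 1"
        unfolding complex_norm_square
        using disc_mult_neq_1[OF a z] by (simp add: sigma_def divide_simps) (simp add: algebra_simps)
      then have "test_fun j a z = (- cnj a * sigma a z + 1) ^ j"
        by (simp only: test_fun_def)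
      also have "\<dots> = (\<Sum>i\<le>j. of_nat (j choose i) * (- cnj a * sigma a z) ^ i * 1 ^ (j - i))"
        by (rule binomial_ring)
      finally show ?thesis
        by (simp only: lessThan_Suc_atMost power_mult_distrib power_one mult_1_right mult.assoc)
    qed
    ultimately show ?thesis
      by (rule B1_le_cong)
  qed
  then show ?thesis
    by blast
qed

section \<open>Derivative estimates\<close>

lemma open_disc: "open disc"
  by (simp add: disc_def)

lemma disc_weight_pos: "w \<in> disc \<Longrightarrow> 0 < 1 - (norm w)\<^sup>2"
  by (simp add: disc_def abs_square_less_1)

lemma B1_norm_le: "B1_le f K \<Longrightarrow> B1_norm f \<le> K"
proof -
  assume "B1_le f K"
  then obtain c a where c: "B1_rep f c a" "(\<Sum>k. norm (c k)) \<le> K"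
    by (auto simp: B1_le_def)
  have "B1_norm f \<le> (\<Sum>k. norm (c k))"
    unfolding B1_norm_def
  proof (rule cInf_lower)
    show "bdd_below {(\<Sum>k. norm (c k)) | c a. B1_rep f c a}"
      by (rule bdd_belowI[of _ 0]) (auto simp: B1_rep_def intro!: suminf_nonneg)
  qed (use c(1) in blast)
  with c(2) show ?thesis
    by simp
qed

lemma norm_le_B1_norm:
  assumes "in_B1 f" "z \<in> disc"
  shows "norm (f z) \<le> B1_norm f"
  unfolding B1_norm_def
proof (rule cInf_greatest)
  \<comment> \<open>\<open>in_B1\<close> supplies a representation, so the infimum is taken over a
    nonempty set.\<close>
  show "{(\<Sum>k. norm (c k)) | c a. B1_rep f c a} \<noteq> {}"
    using assms(1) by (auto simp: in_B1_def)
  fix x assume "x \<in> {(\<Sum>k. norm (c k)) | c a. B1_rep f c a}"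
  then have "B1_le f x"
    by (auto simp: B1_le_def)
  then show "norm (f z) \<le> x"
    using assms(2) by (rule B1_le_norm)
qed

lemma higher_deriv_bound_disc:
  assumes f: "f holomorphic_on disc" and B: "\<And>z. z \<in> disc \<Longrightarrow> norm (f z) \<le> B" and w: "w \<in> disc"
  shows "norm ((deriv ^^ k) f w) \<le> fact k * 4 ^ k * B / (1 - (norm w)\<^sup>2) ^ k"
proof -
  \<comment> \<open>Half the distance to the unit circle keeps the closed disc inside. Since
    \<open>1 + |w| \<le> 2\<close>, this radius is at least \<open>(1 - |w|^2) / 4\<close>, the
    origin of \<open>4 ^ k\<close>.\<close>
  define r where "r = (1 - norm w) / 2"
  have w1: "norm w < 1"
    using w by (simp add: disc_def)
  then have r: "r > 0"
    by (simp add: r_def)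
  have sub: "cball w r \<subseteq> disc"
  proof
    fix z assume "z \<in> cball w r"
    then have "norm z \<le> norm w + r"
      using norm_triangle_ineq2[of z w] by (simp add: dist_norm norm_minus_commute)
    then show "z \<in> disc"
      using w1 by (simp add: disc_def r_def field_simps)
  qed
  have B0: "B \<ge> 0"
    using B[OF w] norm_ge_zero order_trans by blast
  have le: "(1 - (norm w)\<^sup>2) / 4 \<le> r"
  proof -
    have "(1 - norm w) * (1 + norm w) \<le> (1 - norm w) * 2"
      using w1 by (intro mult_left_mono) auto
    then show ?thesis
      by (simp add: r_def field_simps power2_eq_square)
  qed
  have "norm ((deriv ^^ k) f w) \<le> fact k * B / r ^ k"
  proof (rule Cauchy_inequality)
    show "f holomorphic_on ball w r"
      using f sub ball_subset_cball by (meson holomorphic_on_subset order_trans)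
    show "continuous_on (cball w r) f"
      using f sub by (meson holomorphic_on_imp_continuous_on holomorphic_on_subset)
    show "norm (f x) \<le> B" if "norm (w - x) = r" for x
      using that sub by (intro B) (auto simp: dist_norm)
  qed (rule r)
  also have "\<dots> \<le> fact k * B / ((1 - (norm w)\<^sup>2) / 4) ^ k"
    using le disc_weight_pos[OF w] B0 r by (intro divide_left_mono power_mono mult_pos_pos) auto
  finally show ?thesis
    by (simp add: power_divide mult_ac)
qed

text \<open>\<open>in_Zyg\<close> makes the set under the supremum bounded above; without that,
  \<open>Zyg_norm\<close> would not control the values. This is why \<open>in_Zyg\<close>
  accompanies every norm bound.\<close>

lemma Zyg_deriv_le:
  assumes "in_Zyg \<alpha> g" "z \<in> disc"
  shows "(1 - (norm z)\<^sup>2) powr \<alpha> * norm (deriv (deriv g) z) \<le> Zyg_norm \<alpha> g"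
proof -
  have "(1 - (norm z)\<^sup>2) powr \<alpha> * norm (deriv (deriv g) z)
      \<le> (SUP z\<in>disc. (1 - (norm z)\<^sup>2) powr \<alpha> * norm (deriv (deriv g) z))"
    using assms by (intro cSUP_upper) (auto simp: in_Zyg_def bdd_above_def)
  then show ?thesis
    by (simp add: Zyg_norm_def add_nonneg_nonneg add_increasing)
qed

section \<open>Derivatives of monomials and test functions\<close>

lemma higher_deriv_monomial:
  "(deriv ^^ k) (\<lambda>w. w ^ n) w = pochhammer (of_nat (Suc n - k)) k * (w :: complex) ^ (n - k)"
  using higher_deriv_power[of k 0 n w] by simp

lemma holomorphic_test_fun: "a \<in> disc \<Longrightarrow> test_fun j a holomorphic_on disc"
  unfolding test_fun_def[abs_def] by (intro holomorphic_intros) (rule disc_mult_neq_1)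

lemma higher_deriv_test_fun:
  assumes "a \<in> disc" "z \<in> disc"
  shows "(deriv ^^ k) (test_fun j a) z = pochhammer (of_nat j) k * cnj a ^ k *
     (1 - of_real ((norm a)\<^sup>2)) ^ j / (1 - cnj a * z) ^ (j + k)"
  using assms(2)
proof (induction k arbitrary: z)
  case 0
  then show ?case
    by (simp add: test_fun_def power_divide)
next
  case (Suc k)
  define A where "A = pochhammer (of_nat j) k * cnj a ^ k * (1 - complex_of_real ((norm a)\<^sup>2)) ^ j"
  define F where "F = (\<lambda>z. A / (1 - cnj a * z) ^ (j + k))"
  have nz: "1 - cnj a * z \<noteq> 0" if "z \<in> disc" for z
    using assms(1) that by (rule disc_mult_neq_1)
  have "(deriv ^^ Suc k) (test_fun j a) z = deriv ((deriv ^^ k) (test_fun j a)) z"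
    by simp
  also have "\<dots> = deriv F z"
  proof (rule complex_derivative_transform_within_open[OF _ _ open_disc Suc.prems])
    show "(deriv ^^ k) (test_fun j a) holomorphic_on disc"
      by (intro holomorphic_higher_deriv holomorphic_test_fun open_disc assms)
    show "F holomorphic_on disc"
      unfolding F_def by (intro holomorphic_intros) (use nz in auto)
    show "(deriv ^^ k) (test_fun j a) w = F w" if "w \<in> disc" for w
      using Suc.IH[OF that] by (simp add: F_def A_def)
  qed
  also have "\<dots> = A * (of_nat (j + k) * cnj a) / (1 - cnj a * z) ^ Suc (j + k)"
  proof (rule DERIV_imp_deriv)
    define n where "n = j + k"
    have "(F has_field_derivative - (A * (of_nat n * (1 - cnj a * z) ^ (n - 1) * (0 - cnj a * 1)))
        / ((1 - cnj a * z) ^ n * (1 - cnj a * z) ^ n)) (at z)"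
      unfolding F_def n_def[symmetric]
      by (rule derivative_eq_intros refl | use nz[OF Suc.prems] in simp)+
    moreover have "- (A * (of_nat n * (1 - cnj a * z) ^ (n - 1) * (0 - cnj a * 1)))
        / ((1 - cnj a * z) ^ n * (1 - cnj a * z) ^ n) = A * (of_nat n * cnj a) / (1 - cnj a * z) ^ Suc n"
      using nz[OF Suc.prems] by (cases n) (auto simp: divide_simps)
    ultimately show "(F has_field_derivative A * (of_nat (j + k) * cnj a) / (1 - cnj a * z) ^ Suc (j + k)) (at z)"
      by (simp only: n_def)
  qed
  finally show ?case
    by (simp add: A_def pochhammer_Suc mult_ac)
qed

text \<open>At the point \<open>a\<close> itself the powers of \<open>1 - |a|^2\<close> belonging to
  j cancel. Thus j survives only in the Pochhammer symbol, and the system obtained by varying j has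
  a constant matrix.\<close>

lemma higher_deriv_test_fun_same:
  assumes "a \<in> disc"
  shows "(deriv ^^ k) (test_fun j a) a
    = pochhammer (of_nat j) k * (cnj a / of_real (1 - (norm a)\<^sup>2)) ^ k"
proof -
  have "1 - cnj a * a = of_real (1 - (norm a)\<^sup>2)"
    by (simp only: of_real_diff of_real_1 complex_norm_square mult.commute)
  moreover have "(of_real (1 - (norm a)\<^sup>2) :: complex) \<noteq> 0"
    using disc_weight_pos[OF assms] by (simp only: of_real_eq_0_iff)
  ultimately show ?thesis
    unfolding higher_deriv_test_fun[OF assms assms]
    by (simp add: power_add power_divide)
qed

section \<open>A linear system with Pochhammer coefficients\<close>

text \<open>\<open>(J + K + 1)!\<close> is the inner product of \<open>t ^ J\<close> and
  \<open>t ^ K\<close> for the weight \<open>t * exp (- t)\<close>, and the right-hand side is its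
  expansion in the Laguerre polynomials of parameter 1: a Cholesky factorization with binomial
  factors and weights \<open>1 / (i + 1)\<close>. The proof is Vandermonde's identity with
  absorption in \<open>Suc K choose Suc i\<close>.\<close>

lemma fact_add_Suc_eq_sum:
  "(fact (J + K + 1) :: real) = fact (J + 1) * fact (K + 1) *
     (\<Sum>i\<le>K. real (J choose i) * real (K choose i) / real (i + 1))"
proof -
  have "real ((J + Suc K) choose K) = (\<Sum>i\<le>K. real (J choose i) * real (Suc K choose (K - i)))"
    unfolding vandermonde[symmetric] by simp
  also have "\<dots> = (\<Sum>i\<le>K. real (K + 1) * (real (J choose i) * real (K choose i) / real (i + 1)))"
  proof (intro sum.cong refl)
    fix i assume "i \<in> {..K}"
    then have "Suc K choose (K - i) = Suc K choose Suc i"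
      using binomial_symmetric[of "Suc i" "Suc K"] by simp
    moreover have "real (Suc i) * real (Suc K choose Suc i) = real (Suc K) * real (K choose i)"
      using arg_cong[OF Suc_times_binomial[of i K], of real] by (simp only: of_nat_mult)
    then have "real (Suc K choose Suc i) = real (K + 1) * real (K choose i) / real (i + 1)"
      by (simp add: field_simps)
    ultimately show "real (J choose i) * real (Suc K choose (K - i))
        = real (K + 1) * (real (J choose i) * real (K choose i) / real (i + 1))"
      by simp
  qed
  finally have "real ((J + Suc K) choose K)
      = real (K + 1) * (\<Sum>i\<le>K. real (J choose i) * real (K choose i) / real (i + 1))"
    by (simp only: sum_distrib_left)
  moreover have "(fact (J + K + 1) :: real) = fact K * fact (J + 1) * real ((J + Suc K) choose K)"
  proof -
    have "fact K * fact (J + 1) * ((J + Suc K) choose K) = (fact (J + K + 1) :: nat)"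
      using binomial_fact_lemma[of K "J + Suc K"] by (simp del: fact_Suc)
    from arg_cong[OF this, of real] show ?thesis
      by (simp only: of_nat_mult of_nat_fact)
  qed
  ultimately show ?thesis
    by (simp add: mult_ac)
qed

text \<open>The range \<open>i < N\<close> is common to all j and k, so that the sums can be
  interchanged later; the added terms vanish with \<open>k - 1 choose i\<close>.\<close>

lemma pochhammer_eq_sum:
  assumes "j > 0" "k > 0" "k \<le> N"
  shows "fact (j - 1) * (pochhammer (of_nat j) k :: complex) = fact j * fact k *
     (\<Sum>i<N. of_nat (j - 1 choose i) * of_nat (k - 1 choose i) / of_nat (i + 1))"
proof -
  obtain J K where jk: "j = Suc J" "k = Suc K"
    using assms by (metis Suc_pred)
  have "fact J * (pochhammer (of_nat j) k :: complex) = fact (J + K + 1)"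
    using pochhammer_product'[of "1 :: complex" J k]
    by (simp add: jk pochhammer_fact add_ac del: fact_Suc pochhammer_Suc)
  also have "\<dots> = complex_of_real (fact (J + K + 1))"
    by (simp del: fact_Suc)
  also have "\<dots> = complex_of_real (fact (J + 1) * fact (K + 1) *
     (\<Sum>i\<le>K. real (J choose i) * real (K choose i) / real (i + 1)))"
    by (simp only: fact_add_Suc_eq_sum)
  also have "(\<Sum>i\<le>K. real (J choose i) * real (K choose i) / real (i + 1))
      = (\<Sum>i<N. real (J choose i) * real (K choose i) / real (i + 1))"
    using assms(3) by (intro sum.mono_neutral_left) (auto simp: jk binomial_eq_0)
  finally show ?thesis
    by (simp add: jk del: fact_Suc)
qed

text \<open>The binomials vanish for j < i, so this is back substitution: the largest index is
  solved from its own row and moved to the right-hand side of the others. It expresses nondegeneracy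
  of the Cholesky factor, using only the rows \<open>i - 1\<close> with \<open>i\<close> in
  \<open>S\<close>.\<close>

lemma triangular_bound:
  assumes "finite S" "\<forall>j\<in>S. j > 0"
  shows "\<exists>C\<ge>0. \<forall>(X :: nat \<Rightarrow> complex) t.
      (\<forall>i\<in>S. norm (\<Sum>j\<in>S. fact j * of_nat (j - 1 choose (i - 1)) * X j) \<le> t) \<longrightarrow>
      (\<Sum>j\<in>S. norm (X j)) \<le> C * t"
  using assms
proof (induction S rule: finite_linorder_max_induct)
  case empty
  then show ?case
    by (intro exI[of _ 0]) auto
next
  case (insert b S)
  from insert.IH insert.prems obtain C where C: "C \<ge> 0" and IH: "\<forall>(X :: nat \<Rightarrow> complex) t.
      (\<forall>i\<in>S. norm (\<Sum>j\<in>S. fact j * of_nat (j - 1 choose (i - 1)) * X j) \<le> t) \<longrightarrow>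
      (\<Sum>j\<in>S. norm (X j)) \<le> C * t"
    by auto
  \<comment> \<open>\<open>F\<close> dominates every coefficient of \<open>X b\<close> in the rows
    of \<open>S\<close>, so moving that unknown across costs at most \<open>F * t\<close>.\<close>
  define F where "F = (\<Sum>i\<in>S. (fact b :: real) * real (b - 1 choose (i - 1)))"
  have F: "F \<ge> 0"
    by (simp add: F_def sum_nonneg)
  have notin: "b \<notin> S"
    using insert by auto
  show ?case
  proof (intro exI[of _ "1 + C * (1 + F)"] conjI allI impI)
    fix X :: "nat \<Rightarrow> complex" and t
    assume *: "\<forall>i\<in>insert b S. norm (\<Sum>j\<in>insert b S. fact j * of_nat (j - 1 choose (i - 1)) * X j) \<le> t"
    have z: "fact j * of_nat (j - 1 choose (b - 1)) * X j = 0" if "j \<in> S" for j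
    proof -
      have "j - 1 < b - 1"
        using that insert.hyps(2) insert.prems by (intro diff_less_mono) (auto simp: Suc_le_eq)
      then show ?thesis
        by (simp add: binomial_eq_0)
    qed
    have "(\<Sum>j\<in>insert b S. fact j * of_nat (j - 1 choose (b - 1)) * X j) = fact b * X b"
      by (simp only: sum.insert[OF insert.hyps(1) notin] sum.neutral[OF ballI, OF z]) simp
    then have "fact b * norm (X b) \<le> t"
      using *[rule_format, of b] by (simp add: norm_mult del: fact_Suc)
    moreover have "1 * norm (X b) \<le> fact b * norm (X b)"
      by (intro mult_right_mono fact_ge_1) auto
    ultimately have Xb: "norm (X b) \<le> t"
      by simp
    then have t: "t \<ge> 0"
      using norm_ge_zero order_trans by blast
    have "(\<Sum>j\<in>S. norm (X j)) \<le> C * (t + F * t)"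
    proof (rule IH[rule_format])
      fix i assume i: "i \<in> S"
      have "(\<Sum>j\<in>insert b S. fact j * of_nat (j - 1 choose (i - 1)) * X j)
         = fact b * of_nat (b - 1 choose (i - 1)) * X b + (\<Sum>j\<in>S. fact j * of_nat (j - 1 choose (i - 1)) * X j)"
        using insert.hyps notin by simp
      then have "(\<Sum>j\<in>S. fact j * of_nat (j - 1 choose (i - 1)) * X j)
         = (\<Sum>j\<in>insert b S. fact j * of_nat (j - 1 choose (i - 1)) * X j)
           - fact b * of_nat (b - 1 choose (i - 1)) * X b"
        by simp
      then have "norm (\<Sum>j\<in>S. fact j * of_nat (j - 1 choose (i - 1)) * X j)
         \<le> norm (\<Sum>j\<in>insert b S. fact j * of_nat (j - 1 choose (i - 1)) * X j)
           + norm (fact b * of_nat (b - 1 choose (i - 1)) * X b)"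
        by (simp only: norm_triangle_ineq4)
      also have "norm (\<Sum>j\<in>insert b S. fact j * of_nat (j - 1 choose (i - 1)) * X j) \<le> t"
        using * i by blast
      also have "norm (fact b * of_nat (b - 1 choose (i - 1)) * X b)
          = fact b * real (b - 1 choose (i - 1)) * norm (X b)"
        by (simp add: norm_mult)
      also have "\<dots> \<le> F * t"
      proof (rule mult_mono)
        show "fact b * real (b - 1 choose (i - 1)) \<le> F"
          unfolding F_def using insert.hyps i by (intro member_le_sum) auto
      qed (use Xb F in auto)
      finally show "norm (\<Sum>j\<in>S. fact j * of_nat (j - 1 choose (i - 1)) * X j) \<le> t + F * t"
        by simp
    qed
    then show "(\<Sum>j\<in>insert b S. norm (X j)) \<le> (1 + C * (1 + F)) * t"
      using insert.hyps notin Xb by (simp add: algebra_simps)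
  qed (use C F in auto)
qed

text \<open>
  The matrix with entries \<open>fact (j - 1) * pochhammer j k = fact (j + k - 1)\<close> is positive definite for
  every set of indices, because \<open>pochhammer_eq_sum\<close> writes it as a weighted sum of squares; so no gap
  structure of \<open>S\<close> is needed.
\<close>

lemma pochhammer_system_bound:
  assumes S: "finite S" "\<forall>j\<in>S. j > 0"
  shows "\<exists>C\<ge>0. \<forall>(X :: nat \<Rightarrow> complex) M.
      (\<forall>j\<in>S. norm (\<Sum>k\<in>S. pochhammer (of_nat j) k * X k) \<le> M) \<longrightarrow>
      (\<forall>k\<in>S. norm (X k) \<le> C * M)"
proof -
  from triangular_bound[OF S] obtain C where C: "C \<ge> 0" and tri: "\<forall>(X :: nat \<Rightarrow> complex) t.
      (\<forall>i\<in>S. norm (\<Sum>j\<in>S. fact j * of_nat (j - 1 choose (i - 1)) * X j) \<le> t) \<longrightarrow>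
      (\<Sum>j\<in>S. norm (X j)) \<le> C * t"
    by blast
  obtain N where N: "\<And>k. k \<in> S \<Longrightarrow> k \<le> N"
    using S(1) by (meson finite_nat_set_iff_bounded_le)
  \<comment> \<open>This constant is read off from the final estimate: \<open>C\<close> enters
    squared from the triangular system, \<open>N\<close> bounds the weights \<open>i + 1\<close>,
    and \<open>fact N\<close> bounds the row scalings \<open>fact (j - 1)\<close>.\<close>
  define D where "D = C\<^sup>2 * (real N * fact N)"
  have D: "D \<ge> 0"
    by (simp add: D_def)
  show ?thesis
  proof (intro exI[of _ D] conjI allI impI ballI D)
    fix X :: "nat \<Rightarrow> complex" and M k0
    assume M: "\<forall>j\<in>S. norm (\<Sum>k\<in>S. pochhammer (of_nat j) k * X k) \<le> M" and k0: "k0 \<in> S"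
    have M0: "M \<ge> 0"
      using M k0 norm_ge_zero order_trans by blast
    define L where "L = (\<lambda>i. \<Sum>j\<in>S. fact j * of_nat (j - 1 choose i) * X j)"
    define b where "b = (\<lambda>j. \<Sum>k\<in>S. pochhammer (of_nat j) k * X k)"
    define n where "n = (\<Sum>j\<in>S. norm (X j))"
    have n: "n \<ge> 0"
      by (simp add: n_def sum_nonneg)
    have b: "fact (j - 1) * b j = fact j * (\<Sum>i<N. of_nat (j - 1 choose i) * L i / of_nat (i + 1))"
      if j: "j \<in> S" for j
    proof -
      have "fact (j - 1) * b j = (\<Sum>k\<in>S. (fact (j - 1) * pochhammer (of_nat j) k) * X k)"
        by (simp add: b_def sum_distrib_left mult.assoc)
      also have "\<dots> = (\<Sum>k\<in>S. (fact j * fact k *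
         (\<Sum>i<N. of_nat (j - 1 choose i) * of_nat (k - 1 choose i) / of_nat (i + 1))) * X k)"
        using S N j by (intro sum.cong refl) (subst pochhammer_eq_sum[where N = N], auto)
      also have "\<dots> = (\<Sum>k\<in>S. \<Sum>i<N. fact j * (of_nat (j - 1 choose i) / of_nat (i + 1)
          * (fact k * of_nat (k - 1 choose i) * X k)))"
        by (simp add: sum_distrib_left sum_distrib_right mult_ac)
      also have "\<dots> = (\<Sum>i<N. \<Sum>k\<in>S. fact j * (of_nat (j - 1 choose i) / of_nat (i + 1)
          * (fact k * of_nat (k - 1 choose i) * X k)))"
        by (rule sum.swap)
      also have "\<dots> = fact j * (\<Sum>i<N. of_nat (j - 1 choose i) * L i / of_nat (i + 1))"
        by (simp add: L_def sum_distrib_left sum_divide_distrib mult_ac)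
      finally show ?thesis .
    qed
    \<comment> \<open>The scaled system is paired with \<open>X\<close> itself. The resulting
      quadratic form is the sum of \<open>|L i|^2 / (i + 1)\<close>.\<close>
    have "(\<Sum>j\<in>S. cnj (X j) * (fact (j - 1) * b j))
        = (\<Sum>j\<in>S. \<Sum>i<N. cnj (fact j * of_nat (j - 1 choose i) * X j) * (L i / of_nat (i + 1)))"
    proof (rule sum.cong[OF refl])
      fix j assume "j \<in> S"
      then have "cnj (X j) * (fact (j - 1) * b j)
          = cnj (X j) * (fact j * (\<Sum>i<N. of_nat (j - 1 choose i) * L i / of_nat (i + 1)))"
        by (simp only: b)
      then show "cnj (X j) * (fact (j - 1) * b j)
          = (\<Sum>i<N. cnj (fact j * of_nat (j - 1 choose i) * X j) * (L i / of_nat (i + 1)))"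
        by (simp add: sum_distrib_left mult_ac)
    qed
    also have "\<dots> = (\<Sum>i<N. \<Sum>j\<in>S. cnj (fact j * of_nat (j - 1 choose i) * X j) * (L i / of_nat (i + 1)))"
      by (rule sum.swap)
    also have "\<dots> = (\<Sum>i<N. cnj (L i) * (L i / of_nat (i + 1)))"
      by (simp only: L_def cnj_sum sum_distrib_right)
    also have "\<dots> = (\<Sum>i<N. complex_of_real ((norm (L i))\<^sup>2 / real (i + 1)))"
      unfolding of_real_divide complex_norm_square by (simp add: mult.commute)
    finally have eq: "(\<Sum>j\<in>S. cnj (X j) * (fact (j - 1) * b j))
        = complex_of_real (\<Sum>i<N. (norm (L i))\<^sup>2 / real (i + 1))"
      by simp
    have "(\<Sum>i<N. (norm (L i))\<^sup>2 / real (i + 1)) = norm (\<Sum>j\<in>S. cnj (X j) * (fact (j - 1) * b j))"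
      unfolding eq norm_of_real by (simp add: sum_nonneg)
    also have "\<dots> \<le> (\<Sum>j\<in>S. norm (X j) * (fact N * M))"
    proof (rule sum_norm_le)
      fix j assume j: "j \<in> S"
      have "(fact (j - 1) :: real) \<le> fact N"
        using N[OF j] by (intro fact_mono) auto
      then have "fact (j - 1) * norm (b j) \<le> fact N * M"
        using M j by (intro mult_mono) (auto simp: b_def)
      then show "norm (cnj (X j) * (fact (j - 1) * b j)) \<le> norm (X j) * (fact N * M)"
        by (simp add: norm_mult mult_left_mono)
    qed
    also have "\<dots> = n * fact N * M"
      by (simp only: n_def sum_distrib_right mult.assoc)
    finally have sumL: "(\<Sum>i<N. (norm (L i))\<^sup>2 / real (i + 1)) \<le> n * fact N * M" .
    have L: "norm (L (i - 1)) \<le> sqrt (real N * (n * fact N * M))" if i: "i \<in> S" for i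
    proof (rule real_le_rsqrt)
      have iN: "i - 1 < N" "i > 0"
        using N[OF i] S i by auto
      have "(norm (L (i - 1)))\<^sup>2 / real N \<le> (norm (L (i - 1)))\<^sup>2 / real (i - 1 + 1)"
        using iN by (intro divide_left_mono) auto
      also have "\<dots> \<le> (\<Sum>i<N. (norm (L i))\<^sup>2 / real (i + 1))"
        using iN by (intro member_le_sum) auto
      also note sumL
      finally show "(norm (L (i - 1)))\<^sup>2 \<le> real N * (n * fact N * M)"
        using iN by (simp add: field_simps)
    qed
    have "n \<le> C * sqrt (real N * (n * fact N * M))"
      using tri[rule_format, of X "sqrt (real N * (n * fact N * M))"] L
      unfolding L_def n_def[symmetric] by blast
    \<comment> \<open>The form is at most \<open>n * fact N * M\<close>, so \<open>n\<close> stands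
      under the root as well. Squaring gives \<open>n * n \<le> D * M * n\<close>, and one factor
      cancels.\<close>
    then have "n\<^sup>2 \<le> (C * sqrt (real N * (n * fact N * M)))\<^sup>2"
      using n by (intro power_mono)
    also have "\<dots> = D * M * n"
      using n M0 by (simp add: power_mult_distrib D_def)
    finally have "n * n \<le> (D * M) * n"
      by (simp add: power2_eq_square)
    then have "n \<le> D * M"
      using n D M0 by (cases "n = 0") (auto simp: mult_le_cancel_right)
    moreover have "norm (X k0) \<le> n"
      unfolding n_def using S k0 by (intro member_le_sum) auto
    ultimately show "norm (X k0) \<le> D * M"
      by simp
  qed
qed

section \<open>The generalized Stevic-Sharma operator\<close>

lemma
  assumes "u holomorphic_on disc" "g holomorphic_on disc" "\<phi> holomorphic_on disc" "\<phi> ` disc \<subseteq> disc"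
  shows holomorphic_mult_comp: "(\<lambda>z. u z * g (\<phi> z)) holomorphic_on disc"
    and deriv_mult_comp: "z \<in> disc \<Longrightarrow>
      deriv (\<lambda>z. u z * g (\<phi> z)) z = deriv u z * g (\<phi> z) + (u z * deriv \<phi> z) * deriv g (\<phi> z)"
proof -
  have "(\<lambda>z. g (\<phi> z)) holomorphic_on disc"
    using holomorphic_on_compose_gen[OF assms(3,2,4)] by (simp add: o_def)
  then show "(\<lambda>z. u z * g (\<phi> z)) holomorphic_on disc"
    by (rule holomorphic_on_mult[OF assms(1)])
  assume z: "z \<in> disc"
  then have "\<phi> z \<in> disc"
    using assms(4) by blast
  then have "((\<lambda>z. g (\<phi> z)) has_field_derivative deriv g (\<phi> z) * deriv \<phi> z) (at z)"
    by (intro DERIV_chain2 holomorphic_derivI[OF _ open_disc] assms z)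
  from DERIV_mult[OF holomorphic_derivI[OF assms(1) open_disc z] this]
  show "deriv (\<lambda>z. u z * g (\<phi> z)) z = deriv u z * g (\<phi> z) + (u z * deriv \<phi> z) * deriv g (\<phi> z)"
    by (intro DERIV_imp_deriv) (simp add: mult_ac)
qed

text \<open>Both summands of the first derivative are again a multiplier times a composition with
  \<phi>, so \<open>deriv_mult_comp\<close> applies to each. Keeping \<open>g\<close> general serves
  both halves of the operator, with \<open>g = f\<close> and with \<open>g\<close> the m-th
  derivative of \<open>f\<close>.\<close>

lemma deriv_deriv_mult_comp:
  assumes u: "u holomorphic_on disc" and g: "g holomorphic_on disc" and \<phi>: "\<phi> holomorphic_on disc"
    and sub: "\<phi> ` disc \<subseteq> disc" and z: "z \<in> disc"
  shows "deriv (deriv (\<lambda>z. u z * g (\<phi> z))) z = deriv (deriv u) z * g (\<phi> z)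
     + (2 * deriv u z * deriv \<phi> z + u z * deriv (deriv \<phi>) z) * deriv g (\<phi> z)
     + u z * (deriv \<phi> z)\<^sup>2 * deriv (deriv g) (\<phi> z)"
proof -
  have u': "deriv u holomorphic_on disc" and g': "deriv g holomorphic_on disc"
    and \<phi>': "deriv \<phi> holomorphic_on disc"
    using u g \<phi> open_disc by (auto intro: holomorphic_deriv)
  have u\<phi>: "(\<lambda>z. u z * deriv \<phi> z) holomorphic_on disc"
    using u \<phi>' by (rule holomorphic_on_mult)
  note h1 = holomorphic_mult_comp[OF u' g \<phi> sub] and h2 = holomorphic_mult_comp[OF u\<phi> g' \<phi> sub]
  have diff: "f field_differentiable (at z)" if "f holomorphic_on disc" for f
    using that open_disc z by (simp add: holomorphic_on_imp_differentiable_at)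
  have "deriv (deriv (\<lambda>z. u z * g (\<phi> z))) z
     = deriv (\<lambda>z. deriv u z * g (\<phi> z) + (u z * deriv \<phi> z) * deriv g (\<phi> z)) z"
  proof (rule complex_derivative_transform_within_open[OF _ _ open_disc z])
    show "deriv (\<lambda>z. u z * g (\<phi> z)) holomorphic_on disc"
      by (rule holomorphic_deriv[OF holomorphic_mult_comp[OF u g \<phi> sub] open_disc])
    show "(\<lambda>z. deriv u z * g (\<phi> z) + (u z * deriv \<phi> z) * deriv g (\<phi> z)) holomorphic_on disc"
      by (rule holomorphic_on_add[OF h1 h2])
  qed (rule deriv_mult_comp[OF u g \<phi> sub])
  also have "\<dots> = deriv (\<lambda>z. deriv u z * g (\<phi> z)) z + deriv (\<lambda>z. (u z * deriv \<phi> z) * deriv g (\<phi> z)) z"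
    by (rule deriv_add[OF diff[OF h1] diff[OF h2]])
  also have "deriv (\<lambda>z. deriv u z * g (\<phi> z)) z
      = deriv (deriv u) z * g (\<phi> z) + (deriv u z * deriv \<phi> z) * deriv g (\<phi> z)"
    by (rule deriv_mult_comp[OF u' g \<phi> sub z])
  also have "deriv (\<lambda>z. (u z * deriv \<phi> z) * deriv g (\<phi> z)) z
      = deriv (\<lambda>z. u z * deriv \<phi> z) z * deriv g (\<phi> z)
        + (u z * deriv \<phi> z * deriv \<phi> z) * deriv (deriv g) (\<phi> z)"
    by (rule deriv_mult_comp[OF u\<phi> g' \<phi> sub z])
  also have "deriv (\<lambda>z. u z * deriv \<phi> z) z = u z * deriv (deriv \<phi>) z + deriv u z * deriv \<phi> z"
    by (rule deriv_mult[OF diff[OF u] diff[OF \<phi>']])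
  finally show ?thesis
    by (simp add: algebra_simps power2_eq_square)
qed

text \<open>\<open>m > 2\<close> keeps the six indices distinct: the sum over the set
  \<open>Q\<close> then has six terms, and no branch of \<open>I_fun\<close> hides another.\<close>

locale stevic_sharma =
  fixes \<alpha> :: real and m :: nat and u v \<phi> :: "complex \<Rightarrow> complex"
  assumes m: "m > 2"
    and u: "u holomorphic_on disc" and v: "v holomorphic_on disc"
    and \<phi>: "\<phi> holomorphic_on disc" and \<phi>_disc: "\<phi> ` disc \<subseteq> disc"
begin

abbreviation Q :: "nat set" where "Q \<equiv> {0, 1, 2, m, m + 1, m + 2}"

abbreviation T :: "(complex \<Rightarrow> complex) \<Rightarrow> complex \<Rightarrow> complex" where "T \<equiv> T_op m u v \<phi>"

abbreviation I :: "nat \<Rightarrow> complex \<Rightarrow> complex" where "I \<equiv> I_fun m u v \<phi>"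

abbreviation W :: "complex \<Rightarrow> real" where "W z \<equiv> (1 - (norm z)\<^sup>2) powr \<alpha>"

lemma \<phi>_in_disc: "z \<in> disc \<Longrightarrow> \<phi> z \<in> disc"
  using \<phi>_disc by blast

lemma T_eq: "T f = (\<lambda>z. u z * f (\<phi> z) + v z * (deriv ^^ m) f (\<phi> z))"
  by (simp add: T_op_def fun_eq_iff)

context
  fixes f :: "complex \<Rightarrow> complex"
  assumes f: "f holomorphic_on disc"
begin

lemma hol_parts:
  "(\<lambda>z. u z * f (\<phi> z)) holomorphic_on disc"
  "(\<lambda>z. v z * (deriv ^^ m) f (\<phi> z)) holomorphic_on disc"
  by (rule holomorphic_mult_comp[OF u f \<phi> \<phi>_disc])
    (rule holomorphic_mult_comp[OF v holomorphic_higher_deriv[OF f open_disc] \<phi> \<phi>_disc])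

lemma holomorphic_T: "T f holomorphic_on disc"
  unfolding T_eq by (rule holomorphic_on_add[OF hol_parts])

lemma deriv_T_add:
  assumes "z \<in> disc"
  shows "deriv (T f) z = deriv (\<lambda>z. u z * f (\<phi> z)) z + deriv (\<lambda>z. v z * (deriv ^^ m) f (\<phi> z)) z"
  unfolding T_eq
  by (intro deriv_add holomorphic_on_imp_differentiable_at[OF _ open_disc assms] hol_parts)

lemma deriv_T:
  assumes z: "z \<in> disc"
  shows "deriv (T f) z = deriv u z * f (\<phi> z) + (u z * deriv \<phi> z) * (deriv ^^ 1) f (\<phi> z)
    + (deriv v z * (deriv ^^ m) f (\<phi> z) + (v z * deriv \<phi> z) * (deriv ^^ (m + 1)) f (\<phi> z))"
  unfolding deriv_T_add[OF z]
  using deriv_mult_comp[OF u f \<phi> \<phi>_disc z]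
    deriv_mult_comp[OF v holomorphic_higher_deriv[OF f open_disc] \<phi> \<phi>_disc z, of m]
  by simp

lemma deriv_deriv_T:
  assumes z: "z \<in> disc"
  shows "deriv (deriv (T f)) z = (\<Sum>k\<in>Q. I k z * (deriv ^^ k) f (\<phi> z))"
proof -
  have "deriv (deriv (T f)) z
      = deriv (\<lambda>z. deriv (\<lambda>z. u z * f (\<phi> z)) z + deriv (\<lambda>z. v z * (deriv ^^ m) f (\<phi> z)) z) z"
    by (rule complex_derivative_transform_within_open[OF _ _ open_disc z])
      (auto intro!: holomorphic_deriv holomorphic_on_add holomorphic_T hol_parts open_disc deriv_T_add)
  also have "\<dots> = deriv (deriv (\<lambda>z. u z * f (\<phi> z))) z
      + deriv (deriv (\<lambda>z. v z * (deriv ^^ m) f (\<phi> z))) z"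
    by (intro deriv_add holomorphic_on_imp_differentiable_at[OF _ open_disc z]
        holomorphic_deriv[OF _ open_disc] hol_parts)
  also have "deriv (deriv (\<lambda>z. u z * f (\<phi> z))) z = I 0 z * f (\<phi> z) + I 1 z * deriv f (\<phi> z)
      + I 2 z * deriv (deriv f) (\<phi> z)"
    unfolding deriv_deriv_mult_comp[OF u f \<phi> \<phi>_disc z] using m by (simp add: I_fun_def)
  also have "deriv (deriv (\<lambda>z. v z * (deriv ^^ m) f (\<phi> z))) z = I m z * (deriv ^^ m) f (\<phi> z)
      + I (m + 1) z * deriv ((deriv ^^ m) f) (\<phi> z)
      + I (m + 2) z * deriv (deriv ((deriv ^^ m) f)) (\<phi> z)"
    unfolding deriv_deriv_mult_comp[OF v holomorphic_higher_deriv[OF f open_disc] \<phi> \<phi>_disc z]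
    using m by (simp add: I_fun_def)
  finally show ?thesis
    using m by (simp add: numeral_2_eq_2)
qed

end

lemma in_B1_bounds:
  assumes "in_B1 f" "w \<in> disc"
  shows "norm ((deriv ^^ k) f w) \<le> fact k * 4 ^ k / (1 - (norm w)\<^sup>2) ^ k * B1_norm f"
  using higher_deriv_bound_disc[of f "B1_norm f" w k] assms norm_le_B1_norm
  by (simp add: in_B1_def)

section \<open>The implications between the three conditions\<close>

lemma bounded_if_quotients_bounded:
  assumes "\<forall>k\<in>Q. \<exists>M. \<forall>z\<in>disc. W z * norm (I k z) / (1 - (norm (\<phi> z))\<^sup>2) ^ k \<le> M"
  shows "bounded_B1_Zyg \<alpha> T"
proof -
  obtain M where M: "\<And>k z. k \<in> Q \<Longrightarrow> z \<in> disc \<Longrightarrow> W z * norm (I k z) / (1 - (norm (\<phi> z))\<^sup>2) ^ k \<le> M k"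
    using bchoice[OF assms] by blast
  have zero: "0 \<in> disc"
    by (simp add: disc_def)
  \<comment> \<open>\<open>E k\<close> is the Cauchy constant at the fixed point \<phi> 0.
    \<open>C0\<close>, \<open>C1\<close> and \<open>C2\<close> belong to the three summands of
    \<open>Zyg_norm\<close>, and only \<open>C2\<close> uses the quotient bounds.\<close>
  define E where "E = (\<lambda>k. fact k * 4 ^ k / (1 - (norm (\<phi> 0))\<^sup>2) ^ k)"
  define C0 where "C0 = norm (u 0) * E 0 + norm (v 0) * E m"
  define C1 where "C1 = norm (deriv u 0) * E 0 + norm (u 0 * deriv \<phi> 0) * E 1
    + (norm (deriv v 0) * E m + norm (v 0 * deriv \<phi> 0) * E (m + 1))"
  define C2 where "C2 = (\<Sum>k\<in>Q. fact k * 4 ^ k * M k)"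
  have "in_Zyg \<alpha> (T f) \<and> Zyg_norm \<alpha> (T f) \<le> (C0 + C1 + C2) * B1_norm f" if f: "in_B1 f" for f
  proof
    have hf: "f holomorphic_on disc"
      using f by (simp add: in_B1_def)
    have B0: "B1_norm f \<ge> 0"
      using norm_le_B1_norm[OF f zero] norm_ge_zero order_trans by blast
    have d0: "norm ((deriv ^^ k) f (\<phi> 0)) \<le> E k * B1_norm f" for k
      unfolding E_def by (rule in_B1_bounds[OF f \<phi>_in_disc[OF zero]])
    have cd: "norm (c * (deriv ^^ k) f (\<phi> 0)) \<le> norm c * E k * B1_norm f" for c k
      using mult_left_mono[OF d0[of k] norm_ge_zero[of c]] by (simp add: norm_mult mult.assoc)
    have 0: "norm (T f 0) \<le> C0 * B1_norm f"
    proof -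
      have "norm (T f 0) \<le> norm (u 0 * (deriv ^^ 0) f (\<phi> 0)) + norm (v 0 * (deriv ^^ m) f (\<phi> 0))"
        unfolding T_op_def using norm_triangle_ineq by auto
      also have "\<dots> \<le> norm (u 0) * E 0 * B1_norm f + norm (v 0) * E m * B1_norm f"
        by (intro add_mono cd)
      finally show ?thesis
        by (simp only: C0_def distrib_right)
    qed
    have 1: "norm (deriv (T f) 0) \<le> C1 * B1_norm f"
    proof -
      have "norm (deriv (T f) 0) \<le> norm (deriv u 0 * (deriv ^^ 0) f (\<phi> 0))
          + norm ((u 0 * deriv \<phi> 0) * (deriv ^^ 1) f (\<phi> 0))
          + (norm (deriv v 0 * (deriv ^^ m) f (\<phi> 0)) + norm ((v 0 * deriv \<phi> 0) * (deriv ^^ (m + 1)) f (\<phi> 0)))"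
        unfolding deriv_T[OF hf zero] funpow_0 by (intro order_trans[OF norm_triangle_ineq] add_mono norm_triangle_ineq)
      also have "\<dots> \<le> norm (deriv u 0) * E 0 * B1_norm f + norm (u 0 * deriv \<phi> 0) * E 1 * B1_norm f
          + (norm (deriv v 0) * E m * B1_norm f + norm (v 0 * deriv \<phi> 0) * E (m + 1) * B1_norm f)"
        by (intro add_mono cd)
      finally show ?thesis
        by (simp only: C1_def distrib_right)
    qed
    have 2: "W z * norm (deriv (deriv (T f)) z) \<le> C2 * B1_norm f" if z: "z \<in> disc" for z
    proof -
      have "W z * norm (deriv (deriv (T f)) z) \<le> W z * (\<Sum>k\<in>Q. norm (I k z * (deriv ^^ k) f (\<phi> z)))"
        unfolding deriv_deriv_T[OF hf z] by (intro mult_left_mono norm_sum) simp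
      also have "\<dots> = (\<Sum>k\<in>Q. W z * norm (I k z) * norm ((deriv ^^ k) f (\<phi> z)))"
        by (simp only: sum_distrib_left norm_mult mult.assoc)
      also have "\<dots> \<le> (\<Sum>k\<in>Q. fact k * 4 ^ k * M k * B1_norm f)"
      proof (rule sum_mono)
        fix k assume k: "k \<in> Q"
        have "W z * norm (I k z) * norm ((deriv ^^ k) f (\<phi> z))
            \<le> W z * norm (I k z) * (fact k * 4 ^ k / (1 - (norm (\<phi> z))\<^sup>2) ^ k * B1_norm f)"
          by (intro mult_left_mono in_B1_bounds[OF f \<phi>_in_disc[OF z]]) simp
        also have "\<dots> = fact k * 4 ^ k * (W z * norm (I k z) / (1 - (norm (\<phi> z))\<^sup>2) ^ k) * B1_norm f"
          by simp
        also have "\<dots> \<le> fact k * 4 ^ k * M k * B1_norm f"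
          by (intro mult_right_mono mult_left_mono M[OF k z] B0) simp
        finally show "W z * norm (I k z) * norm ((deriv ^^ k) f (\<phi> z)) \<le> fact k * 4 ^ k * M k * B1_norm f" .
      qed
      also have "\<dots> = C2 * B1_norm f"
        by (simp only: C2_def sum_distrib_right)
      finally show ?thesis .
    qed
    show "in_Zyg \<alpha> (T f)"
      unfolding in_Zyg_def using holomorphic_T[OF hf] 2 by blast
    have "(SUP z\<in>disc. W z * norm (deriv (deriv (T f)) z)) \<le> C2 * B1_norm f"
      using zero by (intro cSUP_least 2) auto
    then show "Zyg_norm \<alpha> (T f) \<le> (C0 + C1 + C2) * B1_norm f"
      unfolding Zyg_norm_def distrib_right using 0 1 by linarith
  qed
  then show ?thesis
    unfolding bounded_B1_Zyg_def by blast
qed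

text \<open>For the coefficients, \<open>T\<close> is applied to z^n: derivatives of order above n
  vanish, and the one of order n is the constant n!. So \<open>I n\<close> is isolated up to smaller
  indices of \<open>Q\<close>, and strong induction applies.\<close>

lemma tests_bounded_if_bounded:
  assumes "bounded_B1_Zyg \<alpha> T"
  shows "\<exists>M. \<forall>a\<in>disc. in_Zyg \<alpha> (T (test_fun j a)) \<and> Zyg_norm \<alpha> (T (test_fun j a)) \<le> M"
    and "k \<in> Q \<Longrightarrow> \<exists>M. \<forall>z\<in>disc. W z * norm (I k z) \<le> M"
proof -
  obtain C where C: "\<And>f. in_B1 f \<Longrightarrow> in_Zyg \<alpha> (T f) \<and> Zyg_norm \<alpha> (T f) \<le> C * B1_norm f"
    using assms unfolding bounded_B1_Zyg_def by blast
  \<comment> \<open>The absolute value is needed because \<open>C\<close> might be negative while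
    \<open>K\<close> is only an upper bound for the norm.\<close>
  have CK: "in_Zyg \<alpha> (T f) \<and> Zyg_norm \<alpha> (T f) \<le> \<bar>C\<bar> * K"
    if "f holomorphic_on disc" "B1_le f K" for f K
  proof -
    have f: "in_B1 f"
      using that by (auto simp: in_B1_def B1_le_def)
    have "0 \<in> disc"
      by (simp add: disc_def)
    then have "B1_norm f \<ge> 0"
      using norm_le_B1_norm[OF f] norm_ge_zero order_trans by blast
    then have "C * B1_norm f \<le> \<bar>C\<bar> * K"
      using B1_norm_le[OF that(2)] by (intro mult_mono) auto
    then show ?thesis
      using C[OF f] by auto
  qed
  show "\<exists>M. \<forall>a\<in>disc. in_Zyg \<alpha> (T (test_fun j a)) \<and> Zyg_norm \<alpha> (T (test_fun j a)) \<le> M"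
    using B1_le_test_fun[of j] CK[OF holomorphic_test_fun] by blast
  show "k \<in> Q \<Longrightarrow> \<exists>M. \<forall>z\<in>disc. W z * norm (I k z) \<le> M"
  proof (induction k rule: less_induct)
    case (less n)
    have "\<forall>k\<in>{k\<in>Q. k < n}. \<exists>M. \<forall>z\<in>disc. W z * norm (I k z) \<le> M"
      using less.IH by blast
    from bchoice[OF this] obtain M
      where M: "\<And>k z. k \<in> {k\<in>Q. k < n} \<Longrightarrow> z \<in> disc \<Longrightarrow> W z * norm (I k z) \<le> M k"
      by blast
    define P where "P = (\<lambda>k. pochhammer (of_nat (Suc n - k)) k :: complex)"
    obtain K where K: "B1_le (\<lambda>z. z ^ n) K"
      using B1_le_monomial by blast
    have hol: "(\<lambda>z. z ^ n) holomorphic_on disc"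
      by (intro holomorphic_intros)
    have "W z * norm (I n z) \<le> \<bar>C\<bar> * K + (\<Sum>k\<in>{k\<in>Q. k < n}. M k * norm (P k))" if z: "z \<in> disc" for z
    proof -
      define D where "D = (\<lambda>k. (deriv ^^ k) (\<lambda>z. z ^ n) (\<phi> z))"
      have D_eq: "(deriv ^^ k) (\<lambda>z. z ^ n) (\<phi> z) = D k" for k
        by (simp add: D_def)
      have D: "D k = P k * \<phi> z ^ (n - k)" for k
        by (simp add: D_def P_def higher_deriv_monomial)
      \<comment> \<open>For k > n the truncated difference \<open>Suc n - k\<close> is 0, and
        \<open>pochhammer 0 k\<close> is 0 for positive k.\<close>
      have big: "I k z * D k = 0" if "k \<in> Q - {k\<in>Q. k \<le> n}" for k
        using that by (auto simp: D P_def pochhammer_0_left)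
      have "{k\<in>Q. k \<le> n} = insert n {k\<in>Q. k < n}"
        using less.prems by (auto simp only: le_less)
      moreover have "deriv (deriv (T (\<lambda>z. z ^ n))) z = (\<Sum>k\<in>{k\<in>Q. k \<le> n}. I k z * D k)"
        unfolding deriv_deriv_T[OF hol z] D_eq
        by (rule sum.mono_neutral_right) (use big in blast)+
      ultimately have "deriv (deriv (T (\<lambda>z. z ^ n))) z = I n z * D n + (\<Sum>k\<in>{k\<in>Q. k < n}. I k z * D k)"
        by simp
      then have "I n z * D n = deriv (deriv (T (\<lambda>z. z ^ n))) z - (\<Sum>k\<in>{k\<in>Q. k < n}. I k z * D k)"
        by simp
      then have "norm (I n z * D n) \<le> norm (deriv (deriv (T (\<lambda>z. z ^ n))) z)
          + norm (\<Sum>k\<in>{k\<in>Q. k < n}. I k z * D k)"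
        by (simp only: norm_triangle_ineq4)
      also have "\<dots> \<le> norm (deriv (deriv (T (\<lambda>z. z ^ n))) z) + (\<Sum>k\<in>{k\<in>Q. k < n}. norm (I k z * D k))"
        by (intro add_left_mono norm_sum)
      finally have "W z * norm (I n z * D n) \<le> W z * (norm (deriv (deriv (T (\<lambda>z. z ^ n))) z)
          + (\<Sum>k\<in>{k\<in>Q. k < n}. norm (I k z * D k)))"
        by (rule mult_left_mono) simp
      also have "\<dots> = W z * norm (deriv (deriv (T (\<lambda>z. z ^ n))) z)
          + (\<Sum>k\<in>{k\<in>Q. k < n}. W z * norm (I k z) * norm (D k))"
        by (simp only: distrib_left sum_distrib_left norm_mult mult.assoc)
      also have "\<dots> \<le> \<bar>C\<bar> * K + (\<Sum>k\<in>{k\<in>Q. k < n}. M k * norm (P k))"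
      proof (intro add_mono sum_mono)
        show "W z * norm (deriv (deriv (T (\<lambda>z. z ^ n))) z) \<le> \<bar>C\<bar> * K"
          by (rule order_trans[OF Zyg_deriv_le[OF conjunct1[OF CK[OF hol K]] z] conjunct2[OF CK[OF hol K]]])
        fix k assume k: "k \<in> {k\<in>Q. k < n}"
        have "norm (\<phi> z) ^ (n - k) \<le> 1"
          using \<phi>_in_disc[OF z] by (intro power_le_one) (auto simp: disc_def)
        then have "norm (D k) \<le> norm (P k)"
          by (simp add: D norm_mult norm_power mult_left_le)
        moreover have "0 \<le> W z * norm (I k z)"
          by simp
        then have "0 \<le> M k"
          using M[OF k z] by linarith
        ultimately show "W z * norm (I k z) * norm (D k) \<le> M k * norm (P k)"
          using M[OF k z] by (intro mult_mono) auto
      qed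
      finally have "W z * norm (I n z * D n) \<le> \<bar>C\<bar> * K + (\<Sum>k\<in>{k\<in>Q. k < n}. M k * norm (P k))" .
      moreover have "D n = fact n"
        by (simp add: D P_def pochhammer_fact)
      then have "W z * norm (I n z) * 1 \<le> W z * norm (I n z * D n)"
        unfolding norm_mult mult.assoc[symmetric]
        by (intro mult_left_mono) (simp_all add: fact_ge_1)
      ultimately show ?thesis
        by simp
    qed
    then show ?case
      by blast
  qed
qed

text \<open>Index 0 is split off, since the factorization of the matrix uses
  \<open>fact (j - 1)\<close> with positive j. The unknown \<open>X 0\<close> has coefficient 1 in
  every row and is moved to the right-hand side, where the bound on \<open>I 0\<close> controls
  it.\<close>

lemma quotients_bounded_if_tests_bounded:
  assumes tests: "\<And>j. j \<in> Q \<Longrightarrow>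
      \<exists>M. \<forall>a\<in>disc. in_Zyg \<alpha> (T (test_fun j a)) \<and> Zyg_norm \<alpha> (T (test_fun j a)) \<le> M"
    and coeffs: "\<And>k. k \<in> Q \<Longrightarrow> \<exists>M. \<forall>z\<in>disc. W z * norm (I k z) \<le> M"
    and k: "k \<in> Q"
  shows "\<exists>M. \<forall>z\<in>disc. W z * norm (I k z) / (1 - (norm (\<phi> z))\<^sup>2) ^ k \<le> M"
proof (cases "k = 0")
  case True
  then show ?thesis
    using coeffs[of 0] by simp
next
  case False
  define S where "S = {1, 2, m, m + 1, m + 2}"
  have S: "finite S" "\<forall>j\<in>S. j > 0" and SQ: "S \<subseteq> Q" and QS: "Q = insert 0 S" and 0: "0 \<notin> S"
    and kS: "k \<in> S"
    using m k False by (auto simp: S_def)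
  have "\<forall>j\<in>Q. \<exists>M. \<forall>a\<in>disc. in_Zyg \<alpha> (T (test_fun j a)) \<and> Zyg_norm \<alpha> (T (test_fun j a)) \<le> M"
    using tests by blast
  from bchoice[OF this] obtain M1 where M1: "\<And>j a. j \<in> Q \<Longrightarrow> a \<in> disc \<Longrightarrow>
      in_Zyg \<alpha> (T (test_fun j a)) \<and> Zyg_norm \<alpha> (T (test_fun j a)) \<le> M1 j"
    by blast
  have "\<forall>k\<in>Q. \<exists>M. \<forall>z\<in>disc. W z * norm (I k z) \<le> M"
    using coeffs by blast
  from bchoice[OF this] obtain M2 where M2: "\<And>k z. k \<in> Q \<Longrightarrow> z \<in> disc \<Longrightarrow> W z * norm (I k z) \<le> M2 k"
    by blast
  obtain C where C: "C \<ge> 0" and sys: "\<And>(X :: nat \<Rightarrow> complex) M k.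
      \<forall>j\<in>S. norm (\<Sum>k\<in>S. pochhammer (of_nat j) k * X k) \<le> M \<Longrightarrow> k \<in> S \<Longrightarrow> norm (X k) \<le> C * M"
    using pochhammer_system_bound[OF S] by blast
  define M where "M = (\<Sum>j\<in>S. \<bar>M1 j\<bar>) + M2 0"
  \<comment> \<open>The factor \<open>2 ^ k\<close> serves two cases: for
    \<open>|a| \<ge> 1 / 2\<close> it undoes the \<open>|a| ^ k\<close> in \<open>X k\<close>, and
    otherwise it dominates \<open>1 / d ^ k\<close>, so that the coefficient bound alone
    suffices.\<close>
  have main: "W z * norm (I k z) / (1 - (norm (\<phi> z))\<^sup>2) ^ k \<le> 2 ^ k * (C * M + M2 k)"
    if z: "z \<in> disc" for z
  proof -
    define a where "a = \<phi> z"
    have a: "a \<in> disc"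
      using \<phi>_in_disc[OF z] by (simp add: a_def)
    define d where "d = 1 - (norm a)\<^sup>2"
    have d: "d > 0"
      using disc_weight_pos[OF a] by (simp add: d_def)
    define X where "X = (\<lambda>k. of_real (W z) * (I k z * (cnj a / of_real d) ^ k))"
    have Xn: "norm (X k) = W z * norm (I k z) * norm a ^ k / d ^ k" for k
      using d by (simp add: X_def norm_mult norm_power norm_divide power_divide)
    have "norm (\<Sum>k\<in>S. pochhammer (of_nat j) k * X k) \<le> M" if j: "j \<in> S" for j
    proof -
      have jQ: "j \<in> Q" using j SQ by blast
      have "(\<Sum>k\<in>Q. pochhammer (of_nat j) k * X k) = of_real (W z) * deriv (deriv (T (test_fun j a))) z"
        unfolding deriv_deriv_T[OF holomorphic_test_fun[OF a] z] a_def[symmetric]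
          higher_deriv_test_fun_same[OF a] d_def[symmetric] X_def sum_distrib_left
        by (simp only: mult_ac)
      then have "norm (\<Sum>k\<in>Q. pochhammer (of_nat j) k * X k) \<le> M1 j"
        using Zyg_deriv_le[OF conjunct1[OF M1[OF jQ a]] z] M1[OF jQ a] by (simp add: norm_mult)
      moreover have "(\<Sum>k\<in>S. pochhammer (of_nat j) k * X k)
          = (\<Sum>k\<in>Q. pochhammer (of_nat j) k * X k) - X 0"
        unfolding QS using S(1) 0 by simp
      then have "norm (\<Sum>k\<in>S. pochhammer (of_nat j) k * X k)
          \<le> norm (\<Sum>k\<in>Q. pochhammer (of_nat j) k * X k) + norm (X 0)"
        by (simp only: norm_triangle_ineq4)
      moreover have "norm (X 0) \<le> M2 0"
        unfolding Xn using M2[of 0 z] z by simp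
      moreover have "M1 j \<le> (\<Sum>j\<in>S. \<bar>M1 j\<bar>)"
        using member_le_sum[OF j, of "\<lambda>j. \<bar>M1 j\<bar>"] S(1) by auto
      ultimately show ?thesis
        unfolding M_def by linarith
    qed
    then have XM: "norm (X k) \<le> C * M"
      using kS by (intro sys) auto
    have nonneg: "0 \<le> W z * norm (I k z)" "0 \<le> C * M"
      using XM norm_ge_zero[of "X k"] by (simp, linarith)
    have M2k: "W z * norm (I k z) \<le> M2 k"
      using M2[OF k z] .
    show ?thesis
    proof (cases "norm a \<ge> 1 / 2") \<comment> \<open>\<open>X k\<close> carries a factor \<open>cnj a ^ k\<close>, which is useless near 0.\<close>
      case True
      then have "1 \<le> (2 * norm a) ^ k"
        by (intro one_le_power) auto
      then have "W z * norm (I k z) / d ^ k * 1 \<le> W z * norm (I k z) / d ^ k * (2 * norm a) ^ k"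
        using nonneg(1) d by (intro mult_left_mono divide_nonneg_pos) auto
      also have "\<dots> = 2 ^ k * norm (X k)"
        unfolding Xn by (simp add: power_mult_distrib)
      also have "\<dots> \<le> 2 ^ k * (C * M + M2 k)"
        using XM order_trans[OF nonneg(1) M2k] by (intro mult_left_mono) auto
      finally show ?thesis
        by (simp add: d_def a_def)
    next
      case False
      then have "(norm a)\<^sup>2 \<le> (1 / 2)\<^sup>2"
        by (intro power_mono) auto
      then have "1 / 2 \<le> d"
        by (simp add: d_def power2_eq_square)
      then have "1 \<le> (2 * d) ^ k"
        by (intro one_le_power) auto
      then have "1 / d ^ k \<le> 2 ^ k"
        using d by (simp add: power_mult_distrib field_simps)
      then have "W z * norm (I k z) * (1 / d ^ k) \<le> (C * M + M2 k) * 2 ^ k"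
        using M2k nonneg order_trans[OF nonneg(1) M2k] d by (intro mult_mono) auto
      then show ?thesis
        by (simp add: d_def a_def mult.commute)
    qed
  qed
  then show ?thesis
    by blast
qed

end

theorem theorem2p5:
  fixes \<alpha> :: real and m :: nat and u v \<phi> :: "complex \<Rightarrow> complex"
  assumes "\<alpha> > 0" and "m > 2"
    and "u holomorphic_on disc" and "v holomorphic_on disc" and "\<phi> holomorphic_on disc"
    and "\<phi> ` disc \<subseteq> disc"
  defines "Q \<equiv> {0, 1, 2, m, m + 1, m + 2}"
  shows
   "(bounded_B1_Zyg \<alpha> (T_op m u v \<phi>) \<longleftrightarrow>
      (\<forall>j\<in>Q. (\<exists>M. \<forall>a\<in>disc. in_Zyg \<alpha> (T_op m u v \<phi> (test_fun j a)) \<and>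
                               Zyg_norm \<alpha> (T_op m u v \<phi> (test_fun j a)) \<le> M) \<and>
              (\<exists>M. \<forall>z\<in>disc. (1 - (norm z)\<^sup>2) powr \<alpha> * norm (I_fun m u v \<phi> j z) \<le> M))) \<and>
    (bounded_B1_Zyg \<alpha> (T_op m u v \<phi>) \<longleftrightarrow>
      (\<forall>k\<in>Q. \<exists>M. \<forall>z\<in>disc.
          (1 - (norm z)\<^sup>2) powr \<alpha> * norm (I_fun m u v \<phi> k z) / (1 - (norm (\<phi> z))\<^sup>2) ^ k \<le> M))"
    (is "(?i \<longleftrightarrow> ?ii) \<and> (?i \<longleftrightarrow> ?iii)")
proof -
  interpret stevic_sharma \<alpha> m u v \<phi>
    using assms by unfold_locales
  have "?ii" if "?i"
    using tests_bounded_if_bounded[OF that] unfolding Q_def by blast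
  moreover have "?iii" if "?ii"
    using that quotients_bounded_if_tests_bounded unfolding Q_def by blast
  moreover have "?i" if "?iii"
    using that bounded_if_quotients_bounded unfolding Q_def by blast
  ultimately show ?thesis
    by blast
qed

end
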